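(* Let $(K,\Sigma)$ for $\mathbf{H}$, the sequence $\bar n=\langle n_i:i<\omega\rangle$, and $(K^\ell,\Sigma^\ell)$ for $\mathbf{H}^\ell$ ($\ell\in\{0,1\}$) be the specific objects defined in the context. Then: (1) The forcing notions $\mathbb{Q}^*_\infty(K^\ell,\Sigma^\ell)$ (for $\ell=0,1$) are proper. (2) Let $\mathbb{Q}=\{p\in\mathbb{Q}^*_\infty(K,\Sigma):\mathrm{lh}(w^p)=n_i\text{ for some }i<\omega\}$. Then $\mathbb{Q}$ is a dense suborder of $\mathbb{Q}^*_\infty(K,\Sigma)$ and it is isomorphic with a dense suborder of the product $\mathbb{Q}^*_\infty(K^0,\Sigma^0)\times\mathbb{Q}^*_\infty(K^1,\Sigma^1)$. Consequently, the latter forcing collapses $\mathfrak{c}$ to $\aleph_0$.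
   Context: Convention: in forcing, the larger condition is the stronger one. "Collapses $\mathfrak{c}$ to $\aleph_0$" means it forces that $2^\omega\cap\mathbf{V}$ is countable ($\mathbf{V}$ the ground model). $u\vartriangleleft v$ means that the sequence $v$ extends $u$; $\mathrm{lh}(w)$ is the length of $w$. $\log=\log_2$. Creatures. Let $\mathbf{H}$ be a function on $\omega$ with $2\le|\mathbf{H}(m)|<\omega$ for all $m$. A creature for $\mathbf{H}$ is a triple $t=(\mathbf{nor}[t],\mathbf{val}[t],\mathbf{dis}[t])$ where $\mathbf{nor}[t]\in\mathbb{R}^{\ge0}$, $\mathbf{dis}[t]$ is hereditarily countable, and for some integers $m^t_{\rm dn}<m^t_{\rm up}<\omega$, $\emptyset\ne\mathbf{val}[t]\subseteq\{\langle u,v\rangle\in\prod_{i<m^t_{\rm dn}}\mathbf{H}(i)\times\prod_{i<m^t_{\rm up}}\mathbf{H}(i):u\vartriangleleft v\}$; $\mathrm{CR}[\mathbf{H}]$ is the family of all creatures for $\mathbf{H}$. When $m^t_{\rm up}=m^t_{\rm dn}+1$, "$\mathrm{pos}(t)=A$" with $A\subseteq\mathbf{H}(m^t_{\rm dn})$ means $\mathbf{val}[t]=\{\langle u,u^\frown\langle a\rangle\rangle:u\in\prod_{i<m^t_{\rm dn}}\mathbf{H}(i),\ a\in A\}$. Forcing. For $K\subseteq\mathrm{CR}[\mathbf{H}]$, $\Sigma:K\to\mathcal{P}(K)$: for $t_0,\dots,t_n\in K$ with $m^{t_i}_{\rm up}=m^{t_{i+1}}_{\rm dn}$ ($i<n$)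 and $w\in\prod_{i<m^{t_0}_{\rm dn}}\mathbf{H}(i)$, let $\mathrm{pos}(w,t_0,\dots,t_n)=\{v\in\prod_{j<m^{t_n}_{\rm up}}\mathbf{H}(j): w\vartriangleleft v\ \&\ (\forall i\le n)(\langle v\restriction m^{t_i}_{\rm dn},v\restriction m^{t_i}_{\rm up}\rangle\in\mathbf{val}[t_i])\}$. Conditions of $\mathbb{Q}^*_\infty(K,\Sigma)$ are sequences $p=(w^p,t^p_0,t^p_1,\dots)$ with $t^p_i\in K$, $m^{t^p_i}_{\rm up}=m^{t^p_{i+1}}_{\rm dn}$ for all $i$, $w^p\in\prod_{i<m^{t^p_0}_{\rm dn}}\mathbf{H}(i)$ and $\lim_{n\to\infty}\mathbf{nor}[t^p_n]=\infty$. Order: $p\le q$ iff for some $i<\omega$, $w^q\in\mathrm{pos}(w^p,t^p_0,\dots,t^p_{i-1})$ (meaning $w^q=w^p$ if $i=0$) and $t^q_n\in\Sigma(t^p_{n+i})$ for all $n<\omega$. The function $f_k$. For real $x>0$, $i\ge0$ and an integer $k\ge1$, $f_k(x,i)=\frac{\log(\log(\log(x))-i)}{k}$ if all three logarithms are well defined and attain a value $\ge1$; otherwise $f_k(x,i)=1$. The specific objects. Let $\bar m=\langle m_i:i<\omega\rangle$ be an increasing sequence of integers with $m_0=0$ and $m_{i+1}-m_i>4^{i+3}$. For $j<\omega$ let $\mathbf{H}(j)=i+2=\{0,\dots,i+1\}$, where $i$ is such that $m_i\le j<m_{i+1}$. Let $l_n=|\mathbf{H}(n)|$; let $k_n=\lfloor\sqrt{\max\{k\in\omega\setminus\{0\}:f_k(l_n,0)>1\}}\rfloor$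 if $l_n>2^{2^{16}}$, and $k_n=2$ if $l_n\le2^{2^{16}}$. $K$ consists of all creatures $t\in\mathrm{CR}[\mathbf{H}]$ such that $\mathbf{dis}[t]=\langle m^t,A^t,i^t\rangle$ for some $m^t<\omega$, $\emptyset\ne A^t\subseteq\mathbf{H}(m^t)$, $i^t\in\omega$, $0\le i^t\le\log(\log(l_{m^t}))$; and $\mathbf{nor}[t]=f_{k_{m^t}}(|A^t|,i^t)$, $m^t_{\rm dn}=m^t$, $m^t_{\rm up}=m^t+1$, $\mathrm{pos}(t)=A^t$. For $t\in K$, $\Sigma(t)=\{s\in K:m^s=m^t\ \&\ A^s\subseteq A^t\ \&\ i^s\ge i^t\}$. Let $\bar n=\langle n_i:i<\omega\rangle$ be an increasing sequence with $n_0=0$ and $n_{i+1}$ large enough that $k_{n_{i+1}}\ge2\cdot\prod_{j<n_i}|\mathbf{H}(j)|$. Put $U^0=\bigcup_{i<\omega}[n_{2i},n_{2i+1})$, $U^1=\bigcup_{i<\omega}[n_{2i+1},n_{2i+2})$, and let $\pi^\ell:\omega\to U^\ell$ be the increasing enumerations ($\ell=0,1$). Let $\mathbf{H}^\ell=\mathbf{H}\circ\pi^\ell$. $K^\ell$ consists of all creatures $t\in\mathrm{CR}[\mathbf{H}^\ell]$ such that $\mathbf{dis}[t]=\langle m^t,A^t,i^t\rangle$ for some $m^t<\omega$, $\emptyset\ne A^t\subseteq\mathbf{H}^\ell(m^t)$, $i^t\in\omega$, $0\le i^t\le\log(\log(l_n))$, where $n=\pi^\ell(m^t)$; and $m^t_{\rm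 dn}=m^t$, $m^t_{\rm up}=m^t+1$, $\mathrm{pos}(t)=A^t$, $\mathbf{nor}[t]=f_{k_n}(|A^t|,i^t)$ (again $n=\pi^\ell(m^t)$). For $t\in K^\ell$, $\Sigma^\ell(t)=\{s\in K^\ell:m^s=m^t\ \&\ A^s\subseteq A^t\ \&\ i^s\ge i^t\}$. *)

theory Defs
  imports Complex_Main "HOL-Library.Infinite_Set" "HOL-Library.Countable_Set" "HOL-Library.Sublist"
begin

section \<open>Forcing notions\<close>

text \<open>
  The larger condition is the stronger one. Orders are compared on the set of conditions only.
\<close>

record 'p forcing =
  conds :: "'p set"
  le :: "'p \<Rightarrow> 'p \<Rightarrow> bool"

definition forcing_notion :: "'p forcing \<Rightarrow> bool" where
  "forcing_notion P \<longleftrightarrow> conds P \<noteq> {} \<and> (\<forall>p\<in>conds P. le P p p) \<and>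
    (\<forall>p\<in>conds P. \<forall>q\<in>conds P. \<forall>r\<in>conds P. le P p q \<longrightarrow> le P q r \<longrightarrow> le P p r)"

definition prod_forcing :: "'p forcing \<Rightarrow> 'q forcing \<Rightarrow> ('p \<times> 'q) forcing" where
  "prod_forcing P Q =
    \<lparr>conds = conds P \<times> conds Q, le = (\<lambda>x y. le P (fst x) (fst y) \<and> le Q (snd x) (snd y))\<rparr>"

definition suborder :: "'p forcing \<Rightarrow> 'p set \<Rightarrow> 'p forcing" where
  "suborder P D = \<lparr>conds = D, le = le P\<rparr>"

definition dense_in :: "'p forcing \<Rightarrow> 'p set \<Rightarrow> bool" where
  "dense_in P D \<longleftrightarrow> D \<subseteq> conds P \<and> (\<forall>p\<in>conds P. \<exists>q\<in>D. le P p q)"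

definition isomorphic_forcing :: "'p forcing \<Rightarrow> 'q forcing \<Rightarrow> bool" where
  "isomorphic_forcing P Q \<longleftrightarrow> (\<exists>h. bij_betw h (conds P) (conds Q) \<and>
    (\<forall>p\<in>conds P. \<forall>q\<in>conds P. le P p q \<longleftrightarrow> le Q (h p) (h q)))"


section \<open>The forcing relation\<close>

text \<open>
  A sentence of the forcing language is represented by the predicate ``\<open>p\<close> forces it'' on
  conditions; the clauses are the usual recursive clauses of the forcing relation. A subset (in the
  extension) of a ground model set \<open>A\<close> is given by a name \<open>\<tau> \<subseteq> P \<times> A\<close>, with
  interpretation \<open>\<tau>[G] = {x. \<exists>s\<in>G. (s, x) \<in> \<tau>}\<close>; every subset of \<open>A\<close> in the extension has
  such a name. Quantification over a ground model set and over names has the same clauses.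
\<close>

type_synonym 'p sentence = "'p \<Rightarrow> bool"

definition names :: "'p forcing \<Rightarrow> 'a set \<Rightarrow> ('p \<times> 'a) set set" where
  "names P A = Pow (conds P \<times> A)"

definition f_mem :: "'p forcing \<Rightarrow> 'a \<Rightarrow> ('p \<times> 'a) set \<Rightarrow> 'p sentence" where
  "f_mem P x \<tau> p \<longleftrightarrow> (\<forall>q\<in>conds P. le P p q \<longrightarrow>
    (\<exists>r\<in>conds P. le P q r \<and> (\<exists>s. (s, x) \<in> \<tau> \<and> le P s r)))"

definition f_and :: "'p sentence \<Rightarrow> 'p sentence \<Rightarrow> 'p sentence" where
  "f_and \<phi> \<psi> p \<longleftrightarrow> \<phi> p \<and> \<psi> p"

definition f_imp :: "'p forcing \<Rightarrow> 'p sentence \<Rightarrow> 'p sentence \<Rightarrow> 'p sentence" where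
  "f_imp P \<phi> \<psi> p \<longleftrightarrow> (\<forall>q\<in>conds P. le P p q \<longrightarrow> \<phi> q \<longrightarrow> \<psi> q)"

definition f_not :: "'p forcing \<Rightarrow> 'p sentence \<Rightarrow> 'p sentence" where
  "f_not P \<phi> p \<longleftrightarrow> (\<forall>q\<in>conds P. le P p q \<longrightarrow> \<not> \<phi> q)"

definition f_all :: "'a set \<Rightarrow> ('a \<Rightarrow> 'p sentence) \<Rightarrow> 'p sentence" where
  "f_all A \<phi> p \<longleftrightarrow> (\<forall>x\<in>A. \<phi> x p)"

definition f_ex :: "'p forcing \<Rightarrow> 'a set \<Rightarrow> ('a \<Rightarrow> 'p sentence) \<Rightarrow> 'p sentence" where
  "f_ex P A \<phi> p \<longleftrightarrow> (\<forall>q\<in>conds P. le P p q \<longrightarrow> (\<exists>r\<in>conds P. le P q r \<and> (\<exists>x\<in>A. \<phi> x r)))"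

definition forced :: "'p forcing \<Rightarrow> 'p sentence \<Rightarrow> bool" where
  "forced P \<phi> \<longleftrightarrow> (\<forall>p\<in>conds P. \<phi> p)"

text \<open>``\<open>F\<close> is a function from \<open>A\<close> to \<open>B\<close>'', for \<open>F \<in> names P (A \<times> B)\<close>.\<close>

definition f_function ::
  "'p forcing \<Rightarrow> ('p \<times> 'a \<times> 'b) set \<Rightarrow> 'a set \<Rightarrow> 'b set \<Rightarrow> 'p sentence" where
  "f_function P F A B = f_and
    (f_all A (\<lambda>a. f_ex P B (\<lambda>b. f_mem P (a, b) F)))
    (f_all A (\<lambda>a. f_all B (\<lambda>b. f_all (B - {b}) (\<lambda>b'.
      f_not P (f_and (f_mem P (a, b) F) (f_mem P (a, b') F))))))"

text \<open>
  \<open>P\<close> forces that the set of ground model reals is countable: some function of the extension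
  maps \<open>\<omega>\<close> onto \<open>2\<^sup>\<omega> \<inter> V\<close>.
\<close>

definition collapses_continuum :: "'p forcing \<Rightarrow> bool" where
  "collapses_continuum P \<longleftrightarrow> forced P
    (f_ex P (names P (UNIV \<times> UNIV)) (\<lambda>F. f_and
      (f_function P F (UNIV :: nat set) (UNIV :: (nat \<Rightarrow> bool) set))
      (f_all UNIV (\<lambda>x. f_ex P UNIV (\<lambda>n. f_mem P (n, x) F)))))"


section \<open>Properness\<close>

definition ctbl_subsets :: "'x set \<Rightarrow> 'x set set" where
  "ctbl_subsets X = {a. a \<subseteq> X \<and> countable a \<and> infinite a}"

text \<open>
  \<open>S\<close> is stationary in \<open>[X]\<^sup>\<omega>\<close> iff for every function from finite sequences of elements of
  \<open>X\<close> to \<open>X\<close> some member of \<open>S\<close> is closed under it (the sets closed under such a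
  function generate the club filter on \<open>[X]\<^sup>\<omega>\<close>). The second definition is
  the same formula, read in the extension.
\<close>

definition stationary :: "'x set \<Rightarrow> 'x set set \<Rightarrow> bool" where
  "stationary X S \<longleftrightarrow> S \<subseteq> ctbl_subsets X \<and>
    (\<forall>F. (\<forall>s\<in>lists X. F s \<in> X) \<longrightarrow> (\<exists>a\<in>S. \<forall>s\<in>lists a. F s \<in> a))"

definition f_stationary :: "'p forcing \<Rightarrow> 'x set \<Rightarrow> 'x set set \<Rightarrow> 'p sentence" where
  "f_stationary P X S =
    f_all (names P (lists X \<times> X)) (\<lambda>F. f_imp P
      (f_function P F (lists X) X)
      (f_ex P S (\<lambda>a. f_all (lists a) (\<lambda>s. f_ex P a (\<lambda>y. f_mem P (s, y) F)))))"

text \<open>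
  A forcing notion is proper iff for every uncountable set \<open>X\<close> all stationary subsets of
  \<open>[X]\<^sup>\<omega>\<close> remain stationary in the extension. A definition cannot quantify over all sets
  \<open>X\<close> at once, so the type of the elements of \<open>X\<close> is a parameter; full properness
  is the assertion for an arbitrary type \<open>'x\<close>.
\<close>

definition proper_forcing :: "'x itself \<Rightarrow> 'p forcing \<Rightarrow> bool" where
  "proper_forcing _ P \<longleftrightarrow> forcing_notion P \<and>
    (\<forall>(X :: 'x set) S. uncountable X \<longrightarrow> stationary X S \<longrightarrow> forced P (f_stationary P X S))"


section \<open>Creatures and the forcing they determine\<close>

text \<open>Finite sequences \<open>u \<in> (\<Prod>i<n. H i)\<close> are lists of length \<open>n\<close>.\<close>

definition seqs :: "(nat \<Rightarrow> 'v set) \<Rightarrow> nat \<Rightarrow> 'v list set" where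
  "seqs H n = {u. length u = n \<and> (\<forall>i<n. u ! i \<in> H i)}"

record ('v, 'd) creature =
  nor :: real
  val :: "('v list \<times> 'v list) set"
  dis :: 'd

text \<open>
  Hereditary countability of \<open>dis t\<close> is a matter of the type \<open>'d\<close>; below it is
  \<open>nat \<times> nat set \<times> nat\<close>, all of whose elements are hereditarily countable. Creatures are
  used only for \<open>H\<close> whose values are finite with at least two elements.
\<close>

definition CR :: "(nat \<Rightarrow> 'v set) \<Rightarrow> ('v, 'd) creature set" where
  "CR H = {t. nor t \<ge> 0 \<and> (\<exists>md mu. md < mu \<and> val t \<noteq> {} \<and>
    val t \<subseteq> {(u, v). u \<in> seqs H md \<and> v \<in> seqs H mu \<and> prefix u v})}"

text \<open>For a creature \<open>t\<close> these are well defined, since \<open>val t\<close> is nonempty.\<close>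

definition m_dn :: "('v, 'd) creature \<Rightarrow> nat" where
  "m_dn t = (THE n. \<forall>(u, v)\<in>val t. length u = n)"

definition m_up :: "('v, 'd) creature \<Rightarrow> nat" where
  "m_up t = (THE n. \<forall>(u, v)\<in>val t. length v = n)"

definition pos_of :: "(nat \<Rightarrow> 'v set) \<Rightarrow> ('v, 'd) creature \<Rightarrow> 'v set \<Rightarrow> bool" where
  "pos_of H t A \<longleftrightarrow> val t = {(u, u @ [a]) | u a. u \<in> seqs H (m_dn t) \<and> a \<in> A}"

definition pos :: "(nat \<Rightarrow> 'v set) \<Rightarrow> 'v list \<Rightarrow> ('v, 'd) creature list \<Rightarrow> 'v list set" where
  "pos H w ts = (if ts = [] then {w} else
    {v \<in> seqs H (m_up (last ts)). prefix w v \<and>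
      (\<forall>t\<in>set ts. (take (m_dn t) v, take (m_up t) v) \<in> val t)})"

type_synonym ('v, 'd) cond = "'v list \<times> (nat \<Rightarrow> ('v, 'd) creature)"

definition Q_inf :: "(nat \<Rightarrow> 'v set) \<Rightarrow> ('v, 'd) creature set \<Rightarrow>
    (('v, 'd) creature \<Rightarrow> ('v, 'd) creature set) \<Rightarrow> ('v, 'd) cond forcing" where
  "Q_inf H K \<Sigma> =
    \<lparr>conds = {(w, t). (\<forall>i. t i \<in> K) \<and> (\<forall>i. m_up (t i) = m_dn (t (Suc i))) \<and>
        w \<in> seqs H (m_dn (t 0)) \<and> filterlim (\<lambda>n. nor (t n)) at_top sequentially},
     le = (\<lambda>(w, t) (w', t'). \<exists>i. w' \<in> pos H w (map t [0..<i]) \<and> (\<forall>n. t' n \<in> \<Sigma> (t (n + i))))\<rparr>"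


section \<open>The specific objects\<close>

definition f_norm :: "nat \<Rightarrow> real \<Rightarrow> real \<Rightarrow> real" where
  "f_norm k x i =
    (if x > 0 \<and> log 2 x \<ge> 1 \<and> log 2 (log 2 x) \<ge> 1 \<and>
        log 2 (log 2 x) - i > 0 \<and> log 2 (log 2 (log 2 x) - i) \<ge> 1
     then log 2 (log 2 (log 2 x) - i) / real k else 1)"

definition H_of :: "(nat \<Rightarrow> nat) \<Rightarrow> nat \<Rightarrow> nat set" where
  "H_of mbar j = {..< (THE i. mbar i \<le> j \<and> j < mbar (Suc i)) + 2}"

definition l_of :: "(nat \<Rightarrow> nat set) \<Rightarrow> nat \<Rightarrow> nat" where
  "l_of H n = card (H n)"

definition k_of :: "(nat \<Rightarrow> nat set) \<Rightarrow> nat \<Rightarrow> nat" where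
  "k_of H n = (if l_of H n > 2 ^ (2 ^ 16)
    then nat \<lfloor>sqrt (real (Max {k. k > 0 \<and> f_norm k (real (l_of H n)) 0 > 1}))\<rfloor>
    else 2)"

text \<open>
  For an increasing enumeration \<open>\<pi>\<close> of a set of levels: the creatures for \<open>H \<circ> \<pi>\<close>, with
  the parameters \<open>k\<close>, \<open>l\<close> taken at the original level \<open>\<pi> m\<close>.
  The pair \<open>(K, \<Sigma>)\<close> for \<open>H\<close> itself is the case \<open>\<pi> = id\<close>.
\<close>

type_synonym spec_creature = "(nat, nat \<times> nat set \<times> nat) creature"

definition K_of :: "(nat \<Rightarrow> nat set) \<Rightarrow> (nat \<Rightarrow> nat) \<Rightarrow> spec_creature set" where
  "K_of H \<pi> = {t \<in> CR (H \<circ> \<pi>). \<exists>m A i. dis t = (m, A, i) \<and>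
    A \<noteq> {} \<and> A \<subseteq> H (\<pi> m) \<and> real i \<le> log 2 (log 2 (real (l_of H (\<pi> m)))) \<and>
    nor t = f_norm (k_of H (\<pi> m)) (real (card A)) (real i) \<and>
    m_dn t = m \<and> m_up t = m + 1 \<and> pos_of (H \<circ> \<pi>) t A}"

definition Sigma_of :: "(nat \<Rightarrow> nat set) \<Rightarrow> (nat \<Rightarrow> nat) \<Rightarrow> spec_creature \<Rightarrow> spec_creature set" where
  "Sigma_of H \<pi> t = {s \<in> K_of H \<pi>. \<exists>m A i A' i'.
    dis t = (m, A, i) \<and> dis s = (m, A', i') \<and> A' \<subseteq> A \<and> i \<le> i'}"

definition Q_of ::
  "(nat \<Rightarrow> nat set) \<Rightarrow> (nat \<Rightarrow> nat) \<Rightarrow> (nat, nat \<times> nat set \<times> nat) cond forcing" where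
  "Q_of H \<pi> = Q_inf (H \<circ> \<pi>) (K_of H \<pi>) (Sigma_of H \<pi>)"

definition U_of :: "(nat \<Rightarrow> nat) \<Rightarrow> nat \<Rightarrow> nat set" where
  "U_of nbar l = (\<Union>i. {nbar (2 * i + l) ..< nbar (2 * i + l + 1)})"

definition pi_of :: "(nat \<Rightarrow> nat) \<Rightarrow> nat \<Rightarrow> nat \<Rightarrow> nat" where
  "pi_of nbar l = enumerate (U_of nbar l)"

end

theory Submission
  imports Defs "HOL-Library.Disjoint_Sets"
begin

text \<open>
  Properness. At the beginning of a block of \<open>U\<^sup>l\<close> there are fewer stems than the
  parameter \<open>k\<close> of every later level, because the preceding block belongs to the other set.
  So all stems can be treated in turn, each at the cost of one halving, i.e. of \<open>1/k\<close> in every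
  norm, and a fusion over such stages decides a name \<open>F\<close> of a function on the finite sequences
  of a countable set \<open>a\<close>. As every choice of the fusion depends only on finitely many sequences
  from \<open>a\<close>, it suffices that \<open>a\<close> is closed under one ground model function, and a stationary
  set has such a member.

  Collapse. A generic branch determines, block by block, bits in the following way: a subset
  \<open>Z\<close> of the \<open>i + 2\<close> possible values in the \<open>i\<close>-th block turns the values at its first
  \<open>i + 4\<close> places into bits; \<open>i + 3\<close> of these code the subset to be used in the next block, the
  last one is a bit of a real. Sets of possibilities of norm at least \<open>3\<close> are so large compared
  with \<open>log i\<close> that some \<open>Z\<close> splits all of them into two parts of almost full norm. Hence,
  from some block on, any sequence of bits can be forced, and the countably many pairs of a
  starting block and a starting subset give names whose decided values exhaust the ground model
  reals.
\<close>

section \<open>Norms\<close>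

text \<open>An extension that decides a statement may have finitely many levels of very small norm,
  so it cannot be used in a fusion directly. The second component of a level, its index, exists for
  this purpose: raising it by half of the remaining slack makes every stronger level of norm above 1
  so large that restoring the old index leaves a loss of only \<open>1 / k\<close>. The division by
  \<open>k\<close> in the norm is what makes up to \<open>k\<close> stems cost no more than 1 in
  total.

  The square root in \<open>k\<close> serves two opposite ends. If \<open>y\<close> is the threefold
  logarithm of the size \<open>l\<close> of a level above the threshold, then
  \<open>k ^ 2 < y \<le> (k + 1) ^ 2\<close>. The left inequality makes the norm
  \<open>y / k\<close> of the full level tend to infinity, so that conditions exist. The right one
  bounds \<open>l\<close> in terms of \<open>k\<close>, and norm 3 therefore forces a set to have at
  least the eighth power of \<open>log 2 l\<close> elements. Such a set contains many disjoint
  pieces of size logarithmic in \<open>l\<close>, and pieces of this size are large enough for one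
  subset to split all of them at once; this is the source of the collapse.\<close>

definition slack :: "nat \<Rightarrow> nat \<Rightarrow> real" where
  "slack a i = log 2 (log 2 (real a)) - real i"

lemma f_norm_slack:
  assumes "a \<ge> 2" "slack a i \<ge> 2"
  shows "f_norm k (real a) (real i) = log 2 (slack a i) / real k"
proof -
  have 1: "log 2 (real a) \<ge> 1" using assms(1) by (simp add: le_log_iff)
  have 2: "log 2 (log 2 (real a)) - real i \<ge> 2" using assms(2) by (simp add: slack_def)
  then have 3: "log 2 (log 2 (real a)) \<ge> 1" by linarith
  have 4: "log 2 (log 2 (log 2 (real a)) - real i) \<ge> 1" using 2 by (simp add: le_log_iff)
  show ?thesis using assms(1) 1 2 3 4 unfolding f_norm_def slack_def by simp
qed

text \<open>The default value of \<open>f_norm\<close> is 1, so any larger value comes from the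
  logarithmic branch.\<close>

lemma f_norm_gt_1D:
  assumes "f_norm k (real a) (real i) > 1"
  shows "a \<ge> 2" "slack a i \<ge> 2" "f_norm k (real a) (real i) = log 2 (slack a i) / real k"
proof -
  have *: "real a > 0" "log 2 (real a) \<ge> 1" "slack a i > 0" "log 2 (slack a i) \<ge> 1"
    using assms unfolding f_norm_def slack_def by (auto split: if_splits)
  show "a \<ge> 2" using *(1,2) by (simp add: le_log_iff)
  show "slack a i \<ge> 2" using *(3,4) by (simp add: le_log_iff)
  with \<open>a \<ge> 2\<close> show "f_norm k (real a) (real i) = log 2 (slack a i) / real k"
    by (rule f_norm_slack)
qed

lemma f_norm_nonneg: "f_norm k x i \<ge> 0"
  unfolding f_norm_def by auto

lemma slack_ge_powr:
  assumes "f_norm k (real a) (real i) \<ge> \<rho>" "\<rho> > 1" "k \<ge> 1"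
  shows "slack a i \<ge> 2 powr (real k * \<rho>)"
proof -
  note * = f_norm_gt_1D[of k a i]
  have "real k * \<rho> \<le> log 2 (slack a i)"
  proof -
    have "real k * \<rho> \<le> real k * f_norm k (real a) (real i)"
      using assms by (intro mult_left_mono) auto
    moreover have "f_norm k (real a) (real i) = log 2 (slack a i) / real k" using * assms by simp
    then have "real k * f_norm k (real a) (real i) = log 2 (slack a i)" using assms by (simp del: One_nat_def)
    ultimately show ?thesis by simp
  qed
  then show ?thesis using * assms by (simp add: le_log_iff)
qed

text \<open>Halving the argument of the outermost logarithm subtracts 1 there, hence
  \<open>1 / k\<close> after the division. Norm at least 2 gives slack at least 4, so half of it
  still lies in the logarithmic branch.\<close>

lemma f_norm_drop:
  assumes "f_norm k (real a) (real i) \<ge> 2" "k \<ge> 1" "b \<ge> 2" "slack b j \<ge> slack a i / 2"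
  shows "f_norm k (real b) (real j) \<ge> f_norm k (real a) (real i) - 1 / real k"
proof -
  note * = f_norm_gt_1D[of k a i]
  have "slack a i \<ge> 2 powr (real k * 2)" using slack_ge_powr[of 2] assms by simp
  moreover have "2 powr (real k * 2) \<ge> 2 powr 2" using assms(2) by (intro powr_mono) auto
  ultimately have 4: "slack a i \<ge> 4" by simp
  have "log 2 (slack a i / 2) \<le> log 2 (slack b j)" using 4 assms by simp
  moreover have "log 2 (slack a i / 2) = log 2 (slack a i) - 1" using 4 by (simp add: log_divide)
  moreover have "f_norm k (real b) (real j) = log 2 (slack b j) / real k"
    using 4 assms by (intro f_norm_slack) auto
  ultimately show ?thesis using * assms by (simp add: field_simps)
qed

text \<open>The index moves half way towards the double logarithm of \<open>a\<close>, rounded down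
  to remain a natural number.\<close>

definition half :: "nat \<Rightarrow> nat \<Rightarrow> nat" where
  "half a i = i + nat \<lfloor>slack a i / 2\<rfloor>"

lemma slack_half:
  assumes "slack a i \<ge> 0"
  shows "slack a (half a i) \<ge> slack a i / 2"
proof -
  have "real (half a i) = real i + of_int \<lfloor>slack a i / 2\<rfloor>"
    using assms by (simp add: half_def)
  moreover have "of_int \<lfloor>slack a i / 2\<rfloor> \<le> slack a i / 2" by (rule of_int_floor_le)
  moreover have "slack a (half a i) = slack a i + real i - real (half a i)" by (simp add: slack_def)
  ultimately show ?thesis by linarith
qed

text \<open>The point of halving. Slack at least 2 over an index past the half way mark means, over
  the old index, at least that 2 plus the rounded half; the 2 absorbs the rounding.\<close>

lemma slack_unhalf:
  assumes "slack b j \<ge> 2" "half a i \<le> j" "slack a i \<ge> 0"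
  shows "slack b i \<ge> slack a i / 2"
proof -
  have "real (half a i) = real i + of_int \<lfloor>slack a i / 2\<rfloor>"
    using assms by (simp add: half_def)
  moreover have "real (half a i) \<le> real j" using assms by simp
  moreover have "slack b i = slack b j + real j - real i" by (simp add: slack_def)
  ultimately show ?thesis using assms by linarith
qed

section \<open>Conditions as stems with levels\<close>

type_synonym level = "nat set \<times> nat"

definition level_ok :: "(nat \<Rightarrow> nat set) \<Rightarrow> nat \<Rightarrow> level \<Rightarrow> bool" where
  "level_ok H n x \<longleftrightarrow> fst x \<noteq> {} \<and> fst x \<subseteq> H n \<and>
    real (snd x) \<le> log 2 (log 2 (real (l_of H n)))"

definition nrm :: "(nat \<Rightarrow> nat set) \<Rightarrow> nat \<Rightarrow> level \<Rightarrow> real" where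
  "nrm H n x = f_norm (k_of H n) (real (card (fst x))) (real (snd x))"

definition stronger :: "level \<Rightarrow> level \<Rightarrow> bool" where
  "stronger x y \<longleftrightarrow> fst y \<subseteq> fst x \<and> snd x \<le> snd y"

lemma stronger_refl [simp]: "stronger x x"
  by (simp add: stronger_def)

lemma stronger_trans: "stronger x y \<Longrightarrow> stronger y z \<Longrightarrow> stronger x z"
  by (auto simp: stronger_def)

definition mk :: "(nat \<Rightarrow> nat set) \<Rightarrow> (nat \<Rightarrow> nat) \<Rightarrow> nat \<Rightarrow> level \<Rightarrow> spec_creature" where
  "mk H \<pi> m x = \<lparr>nor = nrm H (\<pi> m) x,
     val = {(u, u @ [a]) | u a. u \<in> seqs (H \<circ> \<pi>) m \<and> a \<in> fst x}, dis = (m, x)\<rparr>"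

text \<open>Levels are addressed by their absolute position, so that they need not be shifted when the
  stem grows; the values of \<open>a\<close> below \<open>length w\<close> are irrelevant.\<close>

definition cnd :: "(nat \<Rightarrow> nat set) \<Rightarrow> (nat \<Rightarrow> nat) \<Rightarrow> nat list \<Rightarrow> (nat \<Rightarrow> level) \<Rightarrow>
    (nat, nat \<times> nat set \<times> nat) cond" where
  "cnd H \<pi> w a = (w, \<lambda>n. mk H \<pi> (length w + n) (a (length w + n)))"

definition tends :: "(nat \<Rightarrow> nat set) \<Rightarrow> (nat \<Rightarrow> nat) \<Rightarrow> (nat \<Rightarrow> level) \<Rightarrow> bool" where
  "tends H \<pi> a \<longleftrightarrow> filterlim (\<lambda>m. nrm H (\<pi> m) (a m)) at_top sequentially"

lemma tends_iff: "tends H \<pi> a \<longleftrightarrow> (\<forall>Z. \<exists>N. \<forall>m\<ge>N. nrm H (\<pi> m) (a m) \<ge> Z)"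
  unfolding tends_def filterlim_at_top eventually_sequentially ..

definition valid :: "(nat \<Rightarrow> nat set) \<Rightarrow> (nat \<Rightarrow> nat) \<Rightarrow> nat list \<Rightarrow> (nat \<Rightarrow> level) \<Rightarrow> bool" where
  "valid H \<pi> w a \<longleftrightarrow> w \<in> seqs (H \<circ> \<pi>) (length w) \<and>
    (\<forall>m\<ge>length w. level_ok H (\<pi> m) (a m)) \<and> tends H \<pi> a"

definition ext :: "nat list \<Rightarrow> (nat \<Rightarrow> level) \<Rightarrow> nat list \<Rightarrow> (nat \<Rightarrow> level) \<Rightarrow> bool" where
  "ext w a w' a' \<longleftrightarrow> prefix w w' \<and> (\<forall>m. length w \<le> m \<and> m < length w' \<longrightarrow> w' ! m \<in> fst (a m)) \<and>
    (\<forall>m\<ge>length w'. stronger (a m) (a' m))"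

lemma ext_refl: "ext w a w a"
  by (auto simp: ext_def)

lemma ext_trans:
  assumes 1: "ext w a w' a'" and 2: "ext w' a' w'' a''"
  shows "ext w a w'' a''"
  unfolding ext_def
proof (intro conjI allI impI)
  show "prefix w w''" using assms by (auto simp: ext_def)
next
  fix m assume m: "length w \<le> m \<and> m < length w''"
  show "w'' ! m \<in> fst (a m)"
  proof (cases "m < length w'")
    case True
    then have "w'' ! m = w' ! m" using 2 by (auto simp: ext_def prefix_def nth_append)
    then show ?thesis using 1 True m by (auto simp: ext_def)
  next
    case False
    then have "w'' ! m \<in> fst (a' m)" "stronger (a m) (a' m)" using 1 2 m by (auto simp: ext_def)
    then show ?thesis by (auto simp: stronger_def)
  qed
next
  fix m assume "length w'' \<le> m"
  moreover have "length w' \<le> length w''" using 2 by (auto simp: ext_def prefix_length_le)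
  ultimately show "stronger (a m) (a'' m)"
    using 1 2 unfolding ext_def by (meson le_trans stronger_trans)
qed

lemma ext_prefix_antisym:
  assumes "ext w a w' a'" "ext w' a' w a"
  shows "w = w'" "\<forall>m\<ge>length w. a m = a' m"
proof -
  show w: "w = w'" using assms by (auto simp: ext_def intro: prefix_order.antisym)
  show "\<forall>m\<ge>length w. a m = a' m"
    using assms unfolding w ext_def stronger_def by (auto intro!: prod_eqI order.antisym)
qed

text \<open>What the forcing arguments need of the sizes, without the block structure.
  \<open>full\<close> gives the full levels norms tending to infinity and thereby yields a
  condition.\<close>

locale creature_forcing =
  fixes H :: "nat \<Rightarrow> nat set"
  assumes fin_H: "finite (H n)" and card_H: "card (H n) \<ge> 2" and k_pos: "k_of H n \<ge> 1"
    and full: "filterlim (\<lambda>n. f_norm (k_of H n) (real (l_of H n)) 0) at_top sequentially"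
begin

lemma H_ne: "H n \<noteq> {}"
  using card_H[of n] by auto

lemma seqs_ne: "seqs (H \<circ> \<pi>) m \<noteq> {}"
proof -
  have "map (\<lambda>i. SOME a. a \<in> H (\<pi> i)) [0..<m] \<in> seqs (H \<circ> \<pi>) m"
    using H_ne by (auto simp: seqs_def some_in_eq)
  then show ?thesis by auto
qed

lemma val_mk_ne: "fst x \<noteq> {} \<Longrightarrow> val (mk H \<pi> m x) \<noteq> {}"
  using seqs_ne[of \<pi> m] by (auto simp: mk_def)

lemma m_dn_mk: assumes "fst x \<noteq> {}" shows "m_dn (mk H \<pi> m x) = m"
  unfolding m_dn_def
proof (rule the_equality)
  show "\<forall>(u, v)\<in>val (mk H \<pi> m x). length u = m" by (auto simp: mk_def seqs_def)
next
  fix n assume "\<forall>(u, v)\<in>val (mk H \<pi> m x). length u = n"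
  moreover obtain u a where "u \<in> seqs (H \<circ> \<pi>) m" "a \<in> fst x"
    using seqs_ne[of \<pi> m] assms by blast
  then have "(u, u @ [a]) \<in> val (mk H \<pi> m x)" "length u = m"
    by (auto simp: mk_def seqs_def)
  ultimately show "n = m" by fastforce
qed

lemma m_up_mk: assumes "fst x \<noteq> {}" shows "m_up (mk H \<pi> m x) = Suc m"
  unfolding m_up_def
proof (rule the_equality)
  show "\<forall>(u, v)\<in>val (mk H \<pi> m x). length v = Suc m" by (auto simp: mk_def seqs_def)
next
  fix n assume "\<forall>(u, v)\<in>val (mk H \<pi> m x). length v = n"
  moreover obtain u a where "u \<in> seqs (H \<circ> \<pi>) m" "a \<in> fst x"
    using seqs_ne[of \<pi> m] assms by blast
  then have "(u, u @ [a]) \<in> val (mk H \<pi> m x)" "length (u @ [a]) = Suc m"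
    by (auto simp: mk_def seqs_def)
  ultimately show "n = Suc m" by fastforce
qed

lemma mk_in_CR:
  assumes "level_ok H (\<pi> m) x"
  shows "mk H \<pi> m x \<in> CR (H \<circ> \<pi>)"
proof -
  have "val (mk H \<pi> m x) \<noteq> {}" using assms by (intro val_mk_ne) (auto simp: level_ok_def)
  moreover have "val (mk H \<pi> m x) \<subseteq> {(u, v). u \<in> seqs (H \<circ> \<pi>) m \<and> v \<in> seqs (H \<circ> \<pi>) (Suc m) \<and> prefix u v}"
    using assms by (auto simp: mk_def seqs_def level_ok_def nth_append less_Suc_eq)
  moreover have "nor (mk H \<pi> m x) \<ge> 0" by (simp add: mk_def nrm_def f_norm_nonneg)
  ultimately show ?thesis unfolding CR_def by blast
qed

text \<open>Norm and value of such a creature are determined by \<open>dis\<close>, so it carries no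
  more information than a position and a level. This is what allows conditions to be handled as
  stems with levels.\<close>

lemma K_of_eq: "K_of H \<pi> = {mk H \<pi> m x | m x. level_ok H (\<pi> m) x}"
proof (intro equalityI subsetI)
  fix t assume "t \<in> K_of H \<pi>"
  then obtain m A i where t: "dis t = (m, A, i)" "A \<noteq> {}" "A \<subseteq> H (\<pi> m)"
    "real i \<le> log 2 (log 2 (real (l_of H (\<pi> m))))"
    "nor t = f_norm (k_of H (\<pi> m)) (real (card A)) (real i)" "m_dn t = m" "pos_of (H \<circ> \<pi>) t A"
    by (auto simp: K_of_def)
  have "t = mk H \<pi> m (A, i)"
    using t by (cases t) (simp add: mk_def nrm_def pos_of_def)
  moreover have "level_ok H (\<pi> m) (A, i)" using t by (simp add: level_ok_def)
  ultimately show "t \<in> {mk H \<pi> m x | m x. level_ok H (\<pi> m) x}" by blast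
next
  fix t assume "t \<in> {mk H \<pi> m x | m x. level_ok H (\<pi> m) x}"
  then obtain m x where t: "t = mk H \<pi> m x" and x: "level_ok H (\<pi> m) x" by auto
  have ne: "fst x \<noteq> {}" using x by (simp add: level_ok_def)
  have "pos_of (H \<circ> \<pi>) t (fst x)" unfolding pos_of_def t m_dn_mk[OF ne] by (simp add: mk_def)
  moreover have "dis t = (m, fst x, snd x)" by (simp add: t mk_def)
  moreover have "nor t = f_norm (k_of H (\<pi> m)) (real (card (fst x))) (real (snd x))"
    by (simp add: t mk_def nrm_def)
  moreover have "t \<in> CR (H \<circ> \<pi>)" "m_dn t = m" "m_up t = m + 1"
    using mk_in_CR[of \<pi> m, OF x] m_dn_mk[OF ne] m_up_mk[OF ne] by (simp_all add: t)
  ultimately show "t \<in> K_of H \<pi>" using x unfolding K_of_def level_ok_def by blast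
qed

lemma mk_in_Sigma_iff:
  assumes "level_ok H (\<pi> m) x" "level_ok H (\<pi> m') y"
  shows "mk H \<pi> m' y \<in> Sigma_of H \<pi> (mk H \<pi> m x) \<longleftrightarrow> m' = m \<and> stronger x y"
proof -
  have "mk H \<pi> m' y \<in> K_of H \<pi>" using assms unfolding K_of_eq by blast
  then show ?thesis
    by (cases x; cases y) (auto simp: Sigma_of_def stronger_def mk_def)
qed

lemma level_ok_ne: "level_ok H n x \<Longrightarrow> fst x \<noteq> {}"
  by (simp add: level_ok_def)

lemma conds_Q_of: "conds (Q_of H \<pi>) = {cnd H \<pi> w a | w a. valid H \<pi> w a}"
proof (intro equalityI subsetI)
  fix p assume "p \<in> conds (Q_of H \<pi>)"
  then obtain w t where p: "p = (w, t)" and tK: "\<And>i. t i \<in> K_of H \<pi>"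
    and tS: "\<And>i. m_up (t i) = m_dn (t (Suc i))" and w: "w \<in> seqs (H \<circ> \<pi>) (m_dn (t 0))"
    and lim: "filterlim (\<lambda>n. nor (t n)) at_top sequentially"
    by (auto simp: Q_of_def Q_inf_def)
  have "\<forall>i. \<exists>m x. t i = mk H \<pi> m x \<and> level_ok H (\<pi> m) x" using tK by (auto simp: K_of_eq)
  then obtain m x where t: "\<And>i. t i = mk H \<pi> (m i) (x i)" and ok: "\<And>i. level_ok H (\<pi> (m i)) (x i)"
    by metis
  \<comment> \<open>Adjoining creatures occupy consecutive positions, so all positions are
    determined by the length of the stem.\<close>
  have m_Suc: "m (Suc i) = Suc (m i)" for i
    using tS[of i] ok[of i] ok[of "Suc i"] by (simp add: t m_up_mk m_dn_mk level_ok_ne)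
  have m0: "m 0 = length w" using w ok[of 0] by (simp add: t m_dn_mk level_ok_ne seqs_def)
  have m: "m i = length w + i" for i by (induction i) (auto simp: m0 m_Suc)
  define a where "a n = x (n - length w)" for n
  have ta: "t n = mk H \<pi> (length w + n) (a (length w + n))" for n
    by (simp add: t m a_def)
  have "p = cnd H \<pi> w a" by (auto simp: p cnd_def ta)
  moreover have "valid H \<pi> w a" unfolding valid_def
  proof (intro conjI allI impI)
    show "w \<in> seqs (H \<circ> \<pi>) (length w)" using w ok[of 0] m0 by (simp add: t m_dn_mk level_ok_ne)
    show "level_ok H (\<pi> n) (a n)" if "length w \<le> n" for n
      using ok[of "n - length w"] that by (simp add: m a_def)
    have "filterlim (\<lambda>n. nrm H (\<pi> (n + length w)) (a (n + length w))) at_top sequentially"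
      using lim by (simp add: ta mk_def add.commute)
    then show "tends H \<pi> a" unfolding tends_def filterlim_at_top
      by (subst (asm) eventually_sequentially_seg)
  qed
  ultimately show "p \<in> {cnd H \<pi> w a | w a. valid H \<pi> w a}" by blast
next
  fix p assume "p \<in> {cnd H \<pi> w a | w a. valid H \<pi> w a}"
  then obtain w a where p: "p = cnd H \<pi> w a" and v: "valid H \<pi> w a" by auto
  have ok: "level_ok H (\<pi> (length w + n)) (a (length w + n))" for n using v by (simp add: valid_def)
  have "filterlim (\<lambda>n. nrm H (\<pi> (length w + n)) (a (length w + n))) at_top sequentially"
    using v unfolding valid_def tends_def filterlim_at_top add.commute[of "length w"]
    by (subst eventually_sequentially_seg) simp
  then have "filterlim (\<lambda>n. nor (mk H \<pi> (length w + n) (a (length w + n)))) at_top sequentially"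
    by (simp add: mk_def)
  moreover have "mk H \<pi> (length w + n) (a (length w + n)) \<in> K_of H \<pi>" for n
    using ok[of n] unfolding K_of_eq by blast
  moreover have "m_dn (mk H \<pi> (length w + n) (a (length w + n))) = length w + n"
    "m_up (mk H \<pi> (length w + n) (a (length w + n))) = length w + Suc n" for n
    using level_ok_ne[OF ok[of n]] by (simp_all add: m_dn_mk m_up_mk)
  moreover have "m_dn (mk H \<pi> (length w) (a (length w))) = length w" using level_ok_ne[OF ok[of 0]] by (simp add: m_dn_mk)
  moreover have "m_dn (mk H \<pi> (Suc (length w + n)) (a (Suc (length w + n)))) = Suc (length w + n)" for n
    using level_ok_ne[OF ok[of "Suc n"]] by (simp add: m_dn_mk)
  ultimately show "p \<in> conds (Q_of H \<pi>)" using v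
    by (simp add: p Q_of_def Q_inf_def cnd_def valid_def)
qed

text \<open>The value of a creature \<open>mk\<close> constrains only the last entry, its initial
  part being an arbitrary member of \<open>seqs\<close>; thus each creature tests a single entry of
  \<open>w'\<close>.\<close>

lemma cnd_in_pos_iff:
  assumes "valid H \<pi> w a" "w' \<in> seqs (H \<circ> \<pi>) (length w')"
  shows "w' \<in> pos (H \<circ> \<pi>) w (map (\<lambda>n. mk H \<pi> (length w + n) (a (length w + n))) [0..<i]) \<longleftrightarrow>
    prefix w w' \<and> length w' = length w + i \<and> (\<forall>m. length w \<le> m \<and> m < length w' \<longrightarrow> w' ! m \<in> fst (a m))"
proof (cases "i = 0")
  case True
  then show ?thesis by (auto simp: pos_def prefix_def)
next
  case False
  have ok: "level_ok H (\<pi> (length w + n)) (a (length w + n))" for n using assms by (simp add: valid_def)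
  have ne: "fst (a (length w + n)) \<noteq> {}" for n using ok level_ok_ne by blast
  let ?t = "\<lambda>n. mk H \<pi> (length w + n) (a (length w + n))"
  have last: "last (map ?t [0..<i]) = ?t (i - 1)" using False by (simp add: last_map)
  have up: "m_up (?t (i - 1)) = length w + i" using False m_up_mk[OF ne[of "i - 1"]] by simp
  have up': "m_up (last (map ?t [0..<i])) = length w + i" using last up by simp
  have step: "(take (m_dn (?t n)) w', take (m_up (?t n)) w') \<in> val (?t n) \<longleftrightarrow> w' ! (length w + n) \<in> fst (a (length w + n))"
    if "length w' = length w + i" "n < i" for n
  proof -
    have "take (Suc (length w + n)) w' = take (length w + n) w' @ [w' ! (length w + n)]"
      using that by (intro take_Suc_conv_app_nth) simp
    moreover have "take (length w + n) w' \<in> seqs (H \<circ> \<pi>) (length w + n)"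
      using that assms(2) by (auto simp: seqs_def)
    ultimately show ?thesis by (simp add: m_dn_mk m_up_mk ne) (simp add: mk_def)
  qed
  have "w' \<in> pos (H \<circ> \<pi>) w (map ?t [0..<i]) \<longleftrightarrow>
      length w' = length w + i \<and> prefix w w' \<and> (\<forall>n<i. w' ! (length w + n) \<in> fst (a (length w + n)))"
  proof (cases "length w' = length w + i")
    case True
    have "w' \<in> pos (H \<circ> \<pi>) w (map ?t [0..<i]) \<longleftrightarrow> prefix w w' \<and>
        (\<forall>n<i. (take (m_dn (?t n)) w', take (m_up (?t n)) w') \<in> val (?t n))"
      using False assms(2) True unfolding pos_def up' by auto
    then show ?thesis using step[OF True] True by blast
  next
    case no: False
    then show ?thesis using False unfolding pos_def up' by (auto simp: seqs_def)
  qed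
  moreover have "(\<forall>n<i. w' ! (length w + n) \<in> fst (a (length w + n))) \<longleftrightarrow>
      (\<forall>m. length w \<le> m \<and> m < length w' \<longrightarrow> w' ! m \<in> fst (a m))" if "length w' = length w + i"
    unfolding that by (metis add_less_cancel_left le_add1 le_add_diff_inverse)
  ultimately show ?thesis by blast
qed

lemma le_cnd_iff:
  assumes "valid H \<pi> w a" "valid H \<pi> w' a'"
  shows "le (Q_of H \<pi>) (cnd H \<pi> w a) (cnd H \<pi> w' a') \<longleftrightarrow> ext w a w' a'"
proof -
  have w': "w' \<in> seqs (H \<circ> \<pi>) (length w')" using assms(2) by (simp add: valid_def)
  have sig: "mk H \<pi> (length w' + n) (a' (length w' + n)) \<in>
      Sigma_of H \<pi> (mk H \<pi> (length w + (n + i)) (a (length w + (n + i)))) \<longleftrightarrow>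
      stronger (a (length w' + n)) (a' (length w' + n))" if "length w' = length w + i" for n i
    using that assms by (subst mk_in_Sigma_iff) (auto simp: valid_def ac_simps)
  have "le (Q_of H \<pi>) (cnd H \<pi> w a) (cnd H \<pi> w' a') \<longleftrightarrow>
    (\<exists>i. w' \<in> pos (H \<circ> \<pi>) w (map (\<lambda>n. mk H \<pi> (length w + n) (a (length w + n))) [0..<i]) \<and>
      (\<forall>n. mk H \<pi> (length w' + n) (a' (length w' + n)) \<in>
      Sigma_of H \<pi> (mk H \<pi> (length w + (n + i)) (a (length w + (n + i))))))"
    by (simp add: Q_of_def Q_inf_def cnd_def)
  also have "\<dots> \<longleftrightarrow> (\<exists>i. prefix w w' \<and> length w' = length w + i \<and> (\<forall>m. length w \<le> m \<and> m < length w' \<longrightarrow> w' ! m \<in> fst (a m)) \<and>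
      (\<forall>n. stronger (a (length w' + n)) (a' (length w' + n))))"
    unfolding cnd_in_pos_iff[OF assms(1) w'] using sig by (metis (no_types, lifting))
  also have "\<dots> \<longleftrightarrow> ext w a w' a'"
    unfolding ext_def by (metis le_Suc_ex le_add1 prefix_length_le)
  finally show ?thesis .
qed

lemma cnd_eqI: "\<forall>m\<ge>length w. a m = a' m \<Longrightarrow> cnd H \<pi> w a = cnd H \<pi> w a'"
  by (simp add: cnd_def)

text \<open>Lengthening the stem leaves the levels, hence the norms, untouched, so any prescribed
  length is reached at no cost.\<close>

lemma extend_stem:
  assumes "valid H \<pi> w a" "length w \<le> N"
  obtains w' where "valid H \<pi> w' a" "ext w a w' a" "length w' = N"
proof
  define f where "f m = (SOME x. x \<in> fst (a m))" for m
  have f: "f m \<in> fst (a m)" if "length w \<le> m" for m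
    using assms(1) that unfolding f_def valid_def level_ok_def some_in_eq by blast
  let ?w = "w @ map f [length w..<N]"
  show len: "length ?w = N" using assms(2) by simp
  have nth: "?w ! m = f m" if "length w \<le> m" "m < N" for m
    using that by (simp add: nth_append)
  show "ext w a ?w a" unfolding ext_def using f nth len by auto
  have "?w ! m \<in> H (\<pi> m)" if "m < N" for m
  proof (cases "m < length w")
    case True
    then show ?thesis using assms(1) by (simp add: nth_append valid_def seqs_def)
  next
    case False
    then have "f m \<in> fst (a m)" "fst (a m) \<subseteq> H (\<pi> m)"
      using f[of m] assms(1) by (auto simp: valid_def level_ok_def)
    then show ?thesis using nth[of m] False that by auto
  qed
  then show "valid H \<pi> ?w a" using assms unfolding valid_def len by (auto simp: seqs_def)
qed

lemma valid_full:
  assumes "strict_mono \<pi>"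
  shows "valid H \<pi> [] (\<lambda>m. (H (\<pi> m), 0))"
proof -
  have "0 \<le> log 2 (log 2 (real (l_of H n)))" for n
  proof -
    have "real (l_of H n) \<ge> 2" using card_H[of n] by (simp add: l_of_def)
    then have "log 2 (real (l_of H n)) \<ge> 1" by (simp add: le_log_iff)
    then show ?thesis by simp
  qed
  moreover have "tends H \<pi> (\<lambda>m. (H (\<pi> m), 0))"
    unfolding tends_def nrm_def using filterlim_compose[OF full filterlim_subseq[OF assms]]
    by (simp add: l_of_def)
  ultimately show ?thesis using H_ne by (auto simp: valid_def level_ok_def seqs_def)
qed

lemma forcing_notion_Q_of:
  assumes "strict_mono \<pi>"
  shows "forcing_notion (Q_of H \<pi>)"
  unfolding forcing_notion_def
proof (intro conjI ballI impI)
  show "conds (Q_of H \<pi>) \<noteq> {}" using valid_full[OF assms] unfolding conds_Q_of by blast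
next
  fix p assume "p \<in> conds (Q_of H \<pi>)"
  then show "le (Q_of H \<pi>) p p" by (auto simp: conds_Q_of le_cnd_iff ext_refl)
next
  fix p q r
  assume "p \<in> conds (Q_of H \<pi>)" "q \<in> conds (Q_of H \<pi>)" "r \<in> conds (Q_of H \<pi>)"
    "le (Q_of H \<pi>) p q" "le (Q_of H \<pi>) q r"
  then show "le (Q_of H \<pi>) p r" by (auto simp: conds_Q_of le_cnd_iff intro: ext_trans)
qed

end

section \<open>Properness\<close>

lemma forcing_notion_refl: "forcing_notion P \<Longrightarrow> p \<in> conds P \<Longrightarrow> le P p p"
  by (simp add: forcing_notion_def)

lemma forcing_notion_trans:
  assumes "forcing_notion P" "p \<in> conds P" "q \<in> conds P" "r \<in> conds P" "le P p q" "le P q r"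
  shows "le P p r"
proof -
  have "\<forall>p\<in>conds P. \<forall>q\<in>conds P. \<forall>r\<in>conds P. le P p q \<longrightarrow> le P q r \<longrightarrow> le P p r"
    using assms(1) unfolding forcing_notion_def by (elim conjE)
  from this[rule_format, OF assms(2-6)] show ?thesis .
qed

lemma f_mem_mono:
  assumes P: "forcing_notion P" and p: "p \<in> conds P" "q \<in> conds P" "le P p q" and f: "f_mem P x \<tau> p"
  shows "f_mem P x \<tau> q"
  unfolding f_mem_def
proof (intro ballI impI)
  fix r assume r: "r \<in> conds P" "le P q r"
  then have "le P p r" using forcing_notion_trans[OF P p(1,2) r(1)] p(3) by simp
  with f r(1) show "\<exists>r'\<in>conds P. le P r r' \<and> (\<exists>s. (s, x) \<in> \<tau> \<and> le P s r')"
    unfolding f_mem_def by simp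
qed

lemma f_mem_dense:
  assumes P: "forcing_notion P" and p: "p \<in> conds P"
    and dense: "\<And>q. q \<in> conds P \<Longrightarrow> le P p q \<Longrightarrow> \<exists>r\<in>conds P. le P q r \<and> f_mem P x \<tau> r"
  shows "f_mem P x \<tau> p"
  unfolding f_mem_def
proof (intro ballI impI)
  fix q assume q: "q \<in> conds P" "le P p q"
  then obtain r where r: "r \<in> conds P" "le P q r" "f_mem P x \<tau> r" using dense by auto
  then obtain r' where r': "r' \<in> conds P" "le P r r'" "\<exists>s. (s, x) \<in> \<tau> \<and> le P s r'"
    using forcing_notion_refl[OF P r(1)] unfolding f_mem_def by blast
  have "le P q r'" using forcing_notion_trans[OF P q(1) r(1) r'(1) r(2) r'(2)] .
  with r' show "\<exists>r\<in>conds P. le P q r \<and> (\<exists>s. (s, x) \<in> \<tau> \<and> le P s r)"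
    by auto
qed

definition halve :: "level \<Rightarrow> level" where
  "halve x = (fst x, half (card (fst x)) (snd x))"

lemma stronger_halve [simp]: "stronger x (halve x)"
  by (simp add: stronger_def halve_def half_def)

text \<open>A left inverse of \<open>concat\<close> once the lengths of the pieces are known;
  trailing padding is ignored. It lets one finite sequence stand for a list of sequences, as
  stationarity offers only functions on \<open>lists X\<close>.\<close>

primrec chop :: "nat list \<Rightarrow> 'a list \<Rightarrow> 'a list list" where
  "chop [] z = []" |
  "chop (l # ls) z = take l z # chop ls (drop l z)"

lemma chop_concat: "chop (map length \<sigma>) (concat \<sigma> @ z) = \<sigma>"
  by (induction \<sigma>) auto

section \<open>Halving and the decision of stems\<close>

context creature_forcing
begin

lemma level_ok_halve:
  assumes "level_ok H n x" "nrm H n x \<ge> 2"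
  shows "level_ok H n (halve x)"
proof -
  define a where "a = card (fst x)"
  have n: "f_norm (k_of H n) (real a) (real (snd x)) > 1" using assms(2) by (simp add: nrm_def a_def)
  have 1: "a \<ge> 2" "slack a (snd x) \<ge> 2" using f_norm_gt_1D[OF n] by auto
  have "a \<le> l_of H n" unfolding a_def l_of_def
    using assms(1) fin_H by (intro card_mono) (auto simp: level_ok_def)
  moreover have "1 \<le> log 2 (real a)" using 1 by (simp add: le_log_iff)
  ultimately have "log 2 (log 2 (real a)) \<le> log 2 (log 2 (real (l_of H n)))" using 1 by simp
  moreover have "real (half a (snd x)) = real (snd x) + of_int \<lfloor>slack a (snd x) / 2\<rfloor>"
    using 1 by (simp add: half_def)
  moreover have "of_int \<lfloor>slack a (snd x) / 2\<rfloor> \<le> slack a (snd x)"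
    using of_int_floor_le[of "slack a (snd x) / 2"] 1 by linarith
  ultimately have "real (half a (snd x)) \<le> log 2 (log 2 (real (l_of H n)))"
    unfolding slack_def by linarith
  then show ?thesis using assms(1) by (simp add: level_ok_def halve_def a_def)
qed

lemma nrm_halve:
  assumes "nrm H n x \<ge> 2"
  shows "nrm H n (halve x) \<ge> nrm H n x - 1 / real (k_of H n)"
proof -
  have n: "f_norm (k_of H n) (real (card (fst x))) (real (snd x)) > 1" using assms by (simp add: nrm_def)
  show ?thesis using assms k_pos f_norm_gt_1D[OF n] unfolding nrm_def halve_def fst_conv snd_conv
    by (intro f_norm_drop slack_half) auto
qed

lemma nrm_unhalve:
  assumes "nrm H n x \<ge> 2" "stronger (halve x) y" "nrm H n y > 1"
  shows "nrm H n (fst y, snd x) \<ge> nrm H n x - 1 / real (k_of H n)"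
proof -
  have n: "f_norm (k_of H n) (real (card (fst x))) (real (snd x)) > 1" using assms by (simp add: nrm_def)
  have y: "f_norm (k_of H n) (real (card (fst y))) (real (snd y)) > 1" using assms by (simp add: nrm_def)
  show ?thesis using assms k_pos f_norm_gt_1D[OF n] f_norm_gt_1D[OF y] unfolding nrm_def fst_conv snd_conv
    by (intro f_norm_drop slack_unhalf[where j = "snd y"]) (auto simp: stronger_def halve_def)
qed

text \<open>The two properties of forcing a statement that halving and fusion rely on: it persists
  to extensions, and it holds as soon as it holds densely below.\<close>

definition decision :: "(nat \<Rightarrow> nat) \<Rightarrow> (nat list \<Rightarrow> (nat \<Rightarrow> level) \<Rightarrow> bool) \<Rightarrow> bool" where
  "decision \<pi> D \<longleftrightarrow>
    (\<forall>w a w' a'. valid H \<pi> w a \<longrightarrow> valid H \<pi> w' a' \<longrightarrow> ext w a w' a' \<longrightarrow> D w a \<longrightarrow> D w' a') \<and>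
    (\<forall>w a. valid H \<pi> w a \<longrightarrow>
      (\<forall>u e. valid H \<pi> u e \<longrightarrow> ext w a u e \<longrightarrow> (\<exists>u' e'. valid H \<pi> u' e' \<and> ext u e u' e' \<and> D u' e')) \<longrightarrow>
      D w a)"

lemma decision_mono:
  "decision \<pi> D \<Longrightarrow> valid H \<pi> w a \<Longrightarrow> valid H \<pi> w' a' \<Longrightarrow> ext w a w' a' \<Longrightarrow> D w a \<Longrightarrow> D w' a'"
  unfolding decision_def by blast

text \<open>Only pure extensions, with the same stem, compete. Norms above 1 exclude the default
  value of the norm; \<open>nrm_unhalve\<close> requires this in order to restore the index.\<close>

definition undecidable :: "(nat \<Rightarrow> nat) \<Rightarrow> ('y \<Rightarrow> nat list \<Rightarrow> (nat \<Rightarrow> level) \<Rightarrow> bool) \<Rightarrow> 'y set \<Rightarrow>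
    nat list \<Rightarrow> (nat \<Rightarrow> level) \<Rightarrow> bool" where
  "undecidable \<pi> D X w a \<longleftrightarrow> (\<forall>b. valid H \<pi> w b \<longrightarrow>
    (\<forall>m\<ge>length w. stronger (a m) (b m) \<and> nrm H (\<pi> m) (b m) > 1) \<longrightarrow> \<not> (\<exists>y\<in>X. D y w b))"

lemma undecidable_mono:
  assumes "undecidable \<pi> D X w a" "\<forall>m\<ge>length w. stronger (a m) (a' m)"
  shows "undecidable \<pi> D X w a'"
  unfolding undecidable_def
proof (intro allI impI)
  fix b assume "valid H \<pi> w b" "\<forall>m\<ge>length w. stronger (a' m) (b m) \<and> 1 < nrm H (\<pi> m) (b m)"
  then show "\<not> (\<exists>y\<in>X. D y w b)"
    using assms(1) stronger_trans[OF assms(2)[rule_format]] unfolding undecidable_def by simp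
qed

text \<open>
  Halve all levels. If some condition below the halved one, with nontrivial norms, decides, then
  only finitely many of its levels have small norm, and for these the halving can be undone without
  enlarging the sets of possibilities; hence the decision survives.
\<close>

lemma decide_stem:
  assumes D: "\<And>y. decision \<pi> (D y)" and w: "w \<in> seqs (H \<circ> \<pi>) (length w)"
    and ok: "\<forall>m\<ge>length w. level_ok H (\<pi> m) (a m)"
    and nr: "\<forall>m\<ge>length w. nrm H (\<pi> m) (a m) \<ge> \<rho> m" and lim: "tends H \<pi> a"
    and \<rho>: "\<forall>m\<ge>length w. 2 \<le> \<rho> m \<and> \<rho> m \<le> R"
  shows "\<exists>a'. (\<forall>m\<ge>length w. level_ok H (\<pi> m) (a' m) \<and> stronger (a m) (a' m) \<and>
      nrm H (\<pi> m) (a' m) \<ge> \<rho> m - 1 / real (k_of H (\<pi> m))) \<and> tends H \<pi> a' \<and>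
    ((\<exists>y\<in>X. D y w a') \<or> undecidable \<pi> D X w a')"
proof (cases "undecidable \<pi> D X w (halve \<circ> a)")
  case True
  have n2: "nrm H (\<pi> m) (a m) \<ge> 2" if "m \<ge> length w" for m using nr \<rho> that by force
  have nh: "nrm H (\<pi> m) (halve (a m)) \<ge> nrm H (\<pi> m) (a m) - 1 / real (k_of H (\<pi> m))"
    if "m \<ge> length w" for m using n2[OF that] by (rule nrm_halve)
  have "tends H \<pi> (halve \<circ> a)" unfolding tends_iff
  proof
    fix Z
    obtain N where N: "\<forall>m\<ge>N. nrm H (\<pi> m) (a m) \<ge> Z + 1" using lim unfolding tends_iff by blast
    have "Z \<le> nrm H (\<pi> m) (halve (a m))" if "m \<ge> max N (length w)" for m
    proof -
      have "1 / real (k_of H (\<pi> m)) \<le> 1" using k_pos[of "\<pi> m"] by simp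
      then show ?thesis using N nh[of m] that by force
    qed
    then show "\<exists>N. \<forall>m\<ge>N. Z \<le> nrm H (\<pi> m) ((halve \<circ> a) m)"
      by (intro exI[of _ "max N (length w)"]) auto
  qed
  moreover have "level_ok H (\<pi> m) ((halve \<circ> a) m) \<and> stronger (a m) ((halve \<circ> a) m) \<and>
      nrm H (\<pi> m) ((halve \<circ> a) m) \<ge> \<rho> m - 1 / real (k_of H (\<pi> m))" if "m \<ge> length w" for m
    using nh[OF that] nr that level_ok_halve[of "\<pi> m" "a m"] ok n2[OF that] by force
  ultimately show ?thesis using True by (intro exI[of _ "halve \<circ> a"] conjI) auto
next
  case False
  then obtain b y where b: "valid H \<pi> w b" "\<forall>m\<ge>length w. stronger (halve (a m)) (b m) \<and> nrm H (\<pi> m) (b m) > 1"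
    and y: "y \<in> X" "D y w b" unfolding undecidable_def comp_def by blast
  \<comment> \<open>\<open>R\<close> bounds all target norms, so from \<open>N\<close> on the levels
    of \<open>b\<close> are good enough as they are. Below \<open>c\<close> only the sets of
    \<open>b\<close> are kept, with the old indices.\<close>
  obtain N where N: "\<forall>m\<ge>N. nrm H (\<pi> m) (b m) \<ge> R" using b(1) unfolding valid_def tends_iff by blast
  define c where "c = max N (length w)"
  define a' where "a' m = (if m < c then (fst (b m), snd (a m)) else b m)" for m
  have n2: "nrm H (\<pi> m) (a m) \<ge> 2" if "m \<ge> length w" for m using nr \<rho> that by force
  have okb: "level_ok H (\<pi> m) (b m)" if "m \<ge> length w" for m using b(1) that by (simp add: valid_def)
  have main: "level_ok H (\<pi> m) (a' m) \<and> stronger (a m) (a' m) \<and>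
      nrm H (\<pi> m) (a' m) \<ge> \<rho> m - 1 / real (k_of H (\<pi> m))" if m: "m \<ge> length w" for m
  proof (cases "m < c")
    case True
    have "nrm H (\<pi> m) (fst (b m), snd (a m)) \<ge> nrm H (\<pi> m) (a m) - 1 / real (k_of H (\<pi> m))"
      using n2 b(2) m by (intro nrm_unhalve) auto
    then have "nrm H (\<pi> m) (a' m) \<ge> \<rho> m - 1 / real (k_of H (\<pi> m))"
      using nr m True by (force simp: a'_def)
    moreover have "level_ok H (\<pi> m) (a' m)" using True okb[OF m] ok m by (auto simp: a'_def level_ok_def)
    moreover have "stronger (a m) (a' m)" using True b(2) m by (auto simp: a'_def stronger_def halve_def)
    ultimately show ?thesis by blast
  next
    case c: False
    then have "nrm H (\<pi> m) (a' m) \<ge> \<rho> m" using N \<rho> m c order_trans[of "\<rho> m" R "nrm H (\<pi> m) (b m)"]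
      by (simp add: a'_def c_def)
    moreover have "0 \<le> 1 / real (k_of H (\<pi> m))" by simp
    ultimately have "nrm H (\<pi> m) (a' m) \<ge> \<rho> m - 1 / real (k_of H (\<pi> m))" by linarith
    moreover have "stronger (a m) (a' m)" using c b(2) m
      by (auto simp: a'_def intro: stronger_trans[OF stronger_halve])
    moreover have "level_ok H (\<pi> m) (a' m)" using c okb[OF m] by (simp add: a'_def)
    ultimately show ?thesis by blast
  qed
  have lim': "tends H \<pi> a'" unfolding tends_iff
  proof
    fix Z
    obtain M where "\<forall>m\<ge>M. nrm H (\<pi> m) (b m) \<ge> Z" using b(1) unfolding valid_def tends_iff by blast
    then show "\<exists>N. \<forall>m\<ge>N. Z \<le> nrm H (\<pi> m) (a' m)" by (intro exI[of _ "max M c"]) (auto simp: a'_def)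
  qed
  have v: "valid H \<pi> w a'" using w main lim' by (simp add: valid_def)
  have "D y w a'"
  proof -
    \<comment> \<open>Below \<open>c\<close> the indices of \<open>a'\<close> may be smaller than
      those of \<open>b\<close>, but an index no longer matters once the stem has passed its level.
      From \<open>c\<close> on the two conditions agree.\<close>
    have "\<exists>u' e'. valid H \<pi> u' e' \<and> ext u e u' e' \<and> D y u' e'" if u: "valid H \<pi> u e" "ext w a' u e" for u e
    proof -
      obtain u' where u': "valid H \<pi> u' e" "ext u e u' e" "length u' = max c (length u)"
        using extend_stem[OF u(1), of "max c (length u)"] by auto
      have e: "ext w a' u' e" using u(2) u'(2) by (rule ext_trans)
      have "ext w b u' e" unfolding ext_def
      proof (intro conjI allI impI)
        show "prefix w u'" using e by (simp add: ext_def)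
        show "u' ! m \<in> fst (b m)" if "length w \<le> m \<and> m < length u'" for m
        proof -
          have "u' ! m \<in> fst (a' m)" using e that unfolding ext_def by blast
          moreover have "fst (a' m) = fst (b m)" by (simp add: a'_def)
          ultimately show ?thesis by simp
        qed
        show "stronger (b m) (e m)" if "length u' \<le> m" for m
        proof -
          have "stronger (a' m) (e m)" using e that unfolding ext_def by blast
          then show ?thesis using that u'(3) by (simp add: a'_def)
        qed
      qed
      then have "D y u' e" using D[of y] b(1) u'(1) y(2) unfolding decision_def by meson
      with u'(1,2) show ?thesis by (intro exI[of _ u'] exI[of _ e] conjI)
    qed
    then show ?thesis using D[of y] v unfolding decision_def by blast
  qed
  then have "\<exists>y\<in>X. D y w a'" using y(1) by blast
  then show ?thesis using main lim' by (intro exI[of _ a'] conjI disjI1 allI impI; simp)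
qed

text \<open>Each stem costs \<open>1 / k\<close> and there are at most \<open>k\<close> of them, so
  the bound, starting from at least 3, never drops below the 2 that halving requires. Outcomes for
  earlier stems persist, since both alternatives are inherited by stronger levels under the same
  stem.\<close>

lemma decide_stems:
  assumes D: "\<And>y. decision \<pi> (D y)"
    and ok: "\<forall>m\<ge>c. level_ok H (\<pi> m) (a m)"
    and nr: "\<forall>m\<ge>c. nrm H (\<pi> m) (a m) \<ge> R" and lim: "tends H \<pi> a" and R: "R \<ge> 3"
    and "finite W" "W \<subseteq> seqs (H \<circ> \<pi>) c" "\<forall>m\<ge>c. card W \<le> k_of H (\<pi> m)"
  shows "\<exists>a'. (\<forall>m\<ge>c. level_ok H (\<pi> m) (a' m) \<and> stronger (a m) (a' m) \<and>
      nrm H (\<pi> m) (a' m) \<ge> R - real (card W) / real (k_of H (\<pi> m))) \<and> tends H \<pi> a' \<and>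
    (\<forall>w\<in>W. (\<exists>y\<in>X. D y w a') \<or> undecidable \<pi> D X w a')"
  using assms(6-8)
proof (induction W rule: finite_induct)
  case empty
  then show ?case using ok nr lim by (intro exI[of _ a]) auto
next
  case (insert w W)
  have k: "card W + 1 \<le> k_of H (\<pi> m)" if "m \<ge> c" for m using insert that by auto
  then have k': "card W \<le> k_of H (\<pi> m)" if "m \<ge> c" for m using that by force
  have w: "w \<in> seqs (H \<circ> \<pi>) c" and len: "length w = c" using insert.prems by (auto simp: seqs_def)
  obtain a' where a': "\<And>m. m \<ge> c \<Longrightarrow> level_ok H (\<pi> m) (a' m)" "\<And>m. m \<ge> c \<Longrightarrow> stronger (a m) (a' m)"
      "\<And>m. m \<ge> c \<Longrightarrow> nrm H (\<pi> m) (a' m) \<ge> R - real (card W) / real (k_of H (\<pi> m))" "tends H \<pi> a'"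
      "\<And>w. w \<in> W \<Longrightarrow> (\<exists>y\<in>X. D y w a') \<or> undecidable \<pi> D X w a'"
    using insert.IH insert.prems k' by (metis (no_types, lifting) insert_subset)
  have "2 \<le> R - real (card W) / real (k_of H (\<pi> m)) \<and> R - real (card W) / real (k_of H (\<pi> m)) \<le> R"
    if "m \<ge> c" for m
  proof -
    have "real (card W) / real (k_of H (\<pi> m)) \<le> 1" using k'[OF that] k_pos[of "\<pi> m"] by simp
    then show ?thesis using R by simp
  qed
  then obtain a'' where a'': "\<And>m. m \<ge> c \<Longrightarrow> level_ok H (\<pi> m) (a'' m)" "\<And>m. m \<ge> c \<Longrightarrow> stronger (a' m) (a'' m)"
      "\<And>m. m \<ge> c \<Longrightarrow> nrm H (\<pi> m) (a'' m) \<ge> R - real (card W) / real (k_of H (\<pi> m)) - 1 / real (k_of H (\<pi> m))"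
      "tends H \<pi> a''" "(\<exists>y\<in>X. D y w a'') \<or> undecidable \<pi> D X w a''"
    using decide_stem[of \<pi> D w a' "\<lambda>m. R - real (card W) / real (k_of H (\<pi> m))" R X] D w a'
    unfolding len by blast
  have "(\<exists>y\<in>X. D y w' a'') \<or> undecidable \<pi> D X w' a''" if w': "w' \<in> W" for w'
  proof -
    have "w' \<in> seqs (H \<circ> \<pi>) c" and len': "length w' = c" using insert.prems w' by (auto simp: seqs_def)
    then have "valid H \<pi> w' a'" "valid H \<pi> w' a''" using a' a'' by (auto simp: valid_def)
    moreover have "ext w' a' w' a''" using a''(2) len' by (auto simp: ext_def)
    moreover have "undecidable \<pi> D X w' a' \<Longrightarrow> undecidable \<pi> D X w' a''"
      using a''(2) len' by (auto intro: undecidable_mono)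
    ultimately show ?thesis using a'(5)[OF w'] decision_mono[OF D] by blast
  qed
  moreover have "nrm H (\<pi> m) (a'' m) \<ge> R - real (card (insert w W)) / real (k_of H (\<pi> m))" if "m \<ge> c" for m
    using a''(3)[OF that] insert.hyps by (simp add: add_divide_distrib)
  moreover have "stronger (a m) (a'' m)" if "m \<ge> c" for m
    using a'(2)[OF that] a''(2)[OF that] by (rule stronger_trans)
  ultimately show ?case using a''(1,4,5) by (intro exI[of _ a''] conjI) auto
qed

section \<open>Fusion\<close>

lemma finite_seqs: "finite (seqs (H \<circ> \<pi>) c)"
proof -
  have "seqs (H \<circ> \<pi>) c \<subseteq> {xs. set xs \<subseteq> (\<Union>i<c. H (\<pi> i)) \<and> length xs = c}"
    by (force simp: seqs_def in_set_conv_nth)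
  then show ?thesis using finite_lists_length_eq[of "\<Union>i<c. H (\<pi> i)" c] fin_H
    by (auto intro: finite_subset)
qed

text \<open>One fusion step from length \<open>c\<close> to a longer \<open>c'\<close>, below which
  the levels are frozen. The third component of the new state records, for every decided stem of
  length \<open>c'\<close>, a value on which the decision falls.\<close>

definition fuses :: "(nat \<Rightarrow> nat) \<Rightarrow> ('y \<Rightarrow> nat list \<Rightarrow> (nat \<Rightarrow> level) \<Rightarrow> bool) \<Rightarrow> 'y set \<Rightarrow> nat \<Rightarrow>
    nat \<times> (nat \<Rightarrow> level) \<times> (nat list \<Rightarrow> 'y) \<Rightarrow> nat \<times> (nat \<Rightarrow> level) \<times> (nat list \<Rightarrow> 'y) \<Rightarrow> bool" where
  "fuses \<pi> D X j = (\<lambda>(c, a, _) (c', a', v). c < c' \<and> (\<forall>m<c'. a' m = a m) \<and>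
    (\<forall>m\<ge>c'. level_ok H (\<pi> m) (a' m) \<and> stronger (a m) (a' m) \<and> nrm H (\<pi> m) (a' m) \<ge> real j) \<and>
    tends H \<pi> a' \<and>
    (\<forall>w\<in>seqs (H \<circ> \<pi>) c'. (v w \<in> X \<and> D (v w) w a') \<or> undecidable \<pi> D X w a'))"

lemma fuses_exists:
  assumes D: "\<And>y. decision \<pi> (D y)"
    and good: "\<And>N. \<exists>c\<ge>N. \<forall>m\<ge>c. card (seqs (H \<circ> \<pi>) c) \<le> k_of H (\<pi> m)"
    and ok: "\<forall>m\<ge>c. level_ok H (\<pi> m) (a m)" and lim: "tends H \<pi> a"
  shows "\<exists>st. fuses \<pi> D X j (c, a, v) st"
proof -
  \<comment> \<open>All stems together consume at most 1; the offset 3 also meets the bound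
    \<open>R \<ge> 3\<close> of \<open>decide_stems\<close> when \<open>j\<close> is 0.\<close>
  obtain N where N: "\<forall>m\<ge>N. nrm H (\<pi> m) (a m) \<ge> real j + 3" using lim unfolding tends_iff by blast
  obtain c' where c': "c' \<ge> max N (Suc c)" "\<forall>m\<ge>c'. card (seqs (H \<circ> \<pi>) c') \<le> k_of H (\<pi> m)"
    using good by blast
  have "\<exists>a'. (\<forall>m\<ge>c'. level_ok H (\<pi> m) (a' m) \<and> stronger (a m) (a' m) \<and>
      nrm H (\<pi> m) (a' m) \<ge> (real j + 3) - real (card (seqs (H \<circ> \<pi>) c')) / real (k_of H (\<pi> m))) \<and> tends H \<pi> a' \<and>
    (\<forall>w\<in>seqs (H \<circ> \<pi>) c'. (\<exists>y\<in>X. D y w a') \<or> undecidable \<pi> D X w a')"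
    using c' N ok lim finite_seqs by (intro decide_stems D) auto
  then obtain a' where a': "\<forall>m\<ge>c'. level_ok H (\<pi> m) (a' m) \<and> stronger (a m) (a' m) \<and>
      nrm H (\<pi> m) (a' m) \<ge> (real j + 3) - real (card (seqs (H \<circ> \<pi>) c')) / real (k_of H (\<pi> m))"
    "tends H \<pi> a'" "\<forall>w\<in>seqs (H \<circ> \<pi>) c'. (\<exists>y\<in>X. D y w a') \<or> undecidable \<pi> D X w a'"
    by blast
  have nr: "nrm H (\<pi> m) (a' m) \<ge> real j" if "m \<ge> c'" for m
  proof -
    have "real (card (seqs (H \<circ> \<pi>) c')) / real (k_of H (\<pi> m)) \<le> 1"
      using c'(2) that k_pos[of "\<pi> m"] by simp
    then show ?thesis using a'(1) that by force
  qed
  define b where "b m = (if m < c' then a m else a' m)" for m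
  define v' where "v' w = (SOME y. y \<in> X \<and> D y w b)" for w
  have "tends H \<pi> b" unfolding tends_iff
  proof
    fix Z
    obtain M where "\<forall>m\<ge>M. nrm H (\<pi> m) (a' m) \<ge> Z" using a'(2) unfolding tends_iff by blast
    then show "\<exists>N. \<forall>m\<ge>N. Z \<le> nrm H (\<pi> m) (b m)" by (intro exI[of _ "max M c'"]) (auto simp: b_def)
  qed
  moreover have "(v' w \<in> X \<and> D (v' w) w b) \<or> undecidable \<pi> D X w b" if w: "w \<in> seqs (H \<circ> \<pi>) c'" for w
  proof -
    have len: "length w = c'" using w by (simp add: seqs_def)
    have b: "\<forall>m\<ge>length w. b m = a' m" by (simp add: b_def len)
    then have ud: "undecidable \<pi> D X w a' \<Longrightarrow> undecidable \<pi> D X w b"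
      by (auto intro: undecidable_mono)
    have "valid H \<pi> w a'" "valid H \<pi> w b"
      using w a' \<open>tends H \<pi> b\<close> b len by (auto simp: valid_def)
    moreover have "ext w a' w b" using b by (auto simp: ext_def)
    ultimately have "D y w b" if "D y w a'" for y
      using decision_mono[OF D, of w a' w b] that by blast
    with ud have "(\<exists>y. y \<in> X \<and> D y w b) \<or> undecidable \<pi> D X w b" using a'(3) w by blast
    then show ?thesis unfolding v'_def by (metis (mono_tags, lifting) someI_ex)
  qed
  ultimately have "fuses \<pi> D X j (c, a, v) (c', b, v')"
    using c' nr a'(1) by (auto simp: fuses_def b_def)
  then show ?thesis by blast
qed

text \<open>\<open>A\<close> has to contain the values found by the fusion, while the fusion has to
  treat the members of \<open>lists A\<close>. The circle is broken by running the fusion along all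
  finite lists of sequences and closing \<open>A\<close> under the resulting values, before a single
  branch of this tree is followed.\<close>

lemma fusion:
  fixes D :: "'x list \<Rightarrow> 'x \<Rightarrow> nat list \<Rightarrow> (nat \<Rightarrow> level) \<Rightarrow> bool"
  assumes D: "\<And>s y. decision \<pi> (D s y)"
    and good: "\<And>N. \<exists>c\<ge>N. \<forall>m\<ge>c. card (seqs (H \<circ> \<pi>) c) \<le> k_of H (\<pi> m)"
    and S: "uncountable X" "stationary X S" and v0: "valid H \<pi> w0 a0"
  shows "\<exists>A\<in>S. \<exists>q. valid H \<pi> w0 q \<and> ext w0 a0 w0 q \<and>
    (\<forall>s\<in>lists A. \<forall>u e. valid H \<pi> u e \<longrightarrow> ext w0 q u e \<longrightarrow> (\<exists>y\<in>X. D s y u e) \<longrightarrow>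
      (\<exists>y\<in>A. \<exists>u' e'. valid H \<pi> u' e' \<and> ext u e u' e' \<and> D s y u' e'))"
proof -
  \<comment> \<open>The argument lists the sequences treated so far, the latest first. Its length is
    the norm demanded at the next step.\<close>
  define run where "run = rec_list (length w0, a0, \<lambda>_. undefined)
    (\<lambda>s \<sigma> st. SOME st'. fuses \<pi> (D s) X (length \<sigma>) st st')"
  have run_Nil: "run [] = (length w0, a0, \<lambda>_. undefined)" by (simp add: run_def)
  have run_Cons: "run (s # \<sigma>) = (SOME st'. fuses \<pi> (D s) X (length \<sigma>) (run \<sigma>) st')" for s \<sigma>
    by (simp add: run_def)
  define inv where "inv = (\<lambda>(c, a, v :: nat list \<Rightarrow> 'x). c \<ge> length w0 \<and> (\<forall>m\<ge>length w0. level_ok H (\<pi> m) (a m)) \<and> tends H \<pi> a)"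
  have step: "fuses \<pi> (D s) X (length \<sigma>) (run \<sigma>) (run (s # \<sigma>))" if "inv (run \<sigma>)" for s \<sigma>
  proof -
    obtain c a v where r: "run \<sigma> = (c, a, v)" using prod_cases3 by blast
    have "\<exists>st. fuses \<pi> (D s) X (length \<sigma>) (run \<sigma>) st"
      using that unfolding r inv_def by (intro fuses_exists D good) auto
    then show ?thesis unfolding run_Cons by (rule someI_ex)
  qed
  have inv_step: "inv (run (s # \<sigma>))" if "inv (run \<sigma>)" for s \<sigma>
    using step[OF that, of s] that unfolding fuses_def inv_def
    by (auto split: prod.splits) (metis linorder_not_le)
  have inv0: "inv (run [])" using v0 by (auto simp: run_Nil inv_def valid_def)
  have inv: "inv (run \<sigma>)" for \<sigma> by (induction \<sigma>) (auto intro: inv0 inv_step)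
  obtain x0 where x0: "x0 \<in> X" using S(1) by (metis countable_empty equals0I)
  \<comment> \<open>Elements of \<open>X\<close> cannot carry a stem or a list of lengths, so the
    length of the argument of \<open>G\<close> does. Every code occurs at arbitrarily large lengths,
    which leaves room for padding.\<close>
  define dec :: "nat \<Rightarrow> nat list \<times> nat list" where "dec n = from_nat (fst (prod_decode n))" for n
  have dec: "\<exists>n\<ge>N. dec n = t" for N t
    by (rule exI[of _ "prod_encode (to_nat t, N)"]) (simp add: dec_def le_prod_encode_2)
  \<comment> \<open>\<open>x0\<close> is a default where the recorded value lies outside
    \<open>X\<close>, as it may for an undecided stem.\<close>
  define G where "G z = (let y = snd (snd (run (chop (snd (dec (length z))) z))) (fst (dec (length z)))
    in if y \<in> X then y else x0)" for z
  have "\<forall>s\<in>lists X. G s \<in> X" using x0 by (auto simp: G_def Let_def)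
  then obtain A where A: "A \<in> S" "\<forall>s\<in>lists A. G s \<in> A" using S(2) unfolding stationary_def by blast
  have A': "A \<subseteq> X" "countable A" "infinite A" using A(1) S(2) unfolding stationary_def ctbl_subsets_def by auto
  have val: "snd (snd (run \<sigma>)) w \<in> A" if \<sigma>: "\<sigma> \<in> lists (lists A)" and "snd (snd (run \<sigma>)) w \<in> X" for \<sigma> w
  proof -
    obtain b where b: "b \<in> A" using A'(3) by (metis finite.emptyI ex_in_conv)
    obtain n where n: "n \<ge> length (concat \<sigma>)" "dec n = (w, map length \<sigma>)" using dec by blast
    define z where "z = concat \<sigma> @ replicate (n - length (concat \<sigma>)) b"
    have "length z = n" using n by (simp add: z_def)
    then have "G z = snd (snd (run \<sigma>)) w" using n that(2) by (simp add: G_def z_def chop_concat)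
    moreover have "z \<in> lists A" using \<sigma> b unfolding z_def by (fastforce simp: in_lists_conv_set)
    ultimately show ?thesis using A(2) by metis
  qed
  have cl: "countable (lists A)" "lists A \<noteq> {}" using A'(2) by auto
  \<comment> \<open>Every sequence is treated infinitely often: a condition below the fusion may
    have small norms up to any height and can only be compared with a later step.\<close>
  define s where "s j = from_nat_into (lists A) (fst (prod_decode j))" for j
  have sA: "s j \<in> lists A" for j unfolding s_def by (rule from_nat_into[OF cl(2)])
  have s_inf: "\<exists>j\<ge>N. s j = t" if t: "t \<in> lists A" for N t
  proof -
    obtain i where "from_nat_into (lists A) i = t" using from_nat_into_surj[OF cl(1) t] by blast
    then show ?thesis by (intro exI[of _ "prod_encode (i, N)"]) (simp add: s_def le_prod_encode_2)
  qed
  define \<sigma> where "\<sigma> = rec_nat [] (\<lambda>j r. s j # r)"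
  have \<sigma>_Suc: "\<sigma> (Suc j) = s j # \<sigma> j" and \<sigma>_0: "\<sigma> 0 = []" for j by (simp_all add: \<sigma>_def)
  have len\<sigma>: "length (\<sigma> j) = j" for j by (induction j) (auto simp: \<sigma>_0 \<sigma>_Suc)
  have \<sigma>A: "\<sigma> j \<in> lists (lists A)" for j
  proof (induction j)
    case (Suc j)
    then show ?case using sA[of j] unfolding \<sigma>_Suc by (intro lists.Cons)
  qed (simp add: \<sigma>_0)
  define c where "c j = fst (run (\<sigma> j))" for j
  define a where "a j = fst (snd (run (\<sigma> j)))" for j
  define v where "v j = snd (snd (run (\<sigma> j)))" for j
  have f: "fuses \<pi> (D (s j)) X j (c j, a j, v j) (c (Suc j), a (Suc j), v (Suc j))" for j
    using step[OF inv, of "s j" "\<sigma> j"] by (simp add: c_def a_def v_def \<sigma>_Suc len\<sigma>)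
  have c_Suc: "c j < c (Suc j)" for j using f[of j] unfolding fuses_def prod.case by blast
  have frozen1: "a (Suc j) m = a j m" if "m < c (Suc j)" for j m
    using f[of j] that unfolding fuses_def prod.case by blast
  have f_ge: "stronger (a j m) (a (Suc j) m)" "nrm H (\<pi> m) (a (Suc j) m) \<ge> real j"
    if "m \<ge> c (Suc j)" for j m
    using f[of j] that unfolding fuses_def prod.case by blast+
  have f_dec: "(v (Suc j) w \<in> X \<and> D (s j) (v (Suc j) w) w (a (Suc j))) \<or>
      undecidable \<pi> (D (s j)) X w (a (Suc j))" if "w \<in> seqs (H \<circ> \<pi>) (c (Suc j))" for j w
    using f[of j] that unfolding fuses_def prod.case by blast
  have ok: "level_ok H (\<pi> m) (a j m)" if "m \<ge> length w0" for j m
    using inv[of "\<sigma> j"] that by (auto simp: inv_def a_def split: prod.splits)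
  have c0: "c j \<ge> length w0" for j
    using inv[of "\<sigma> j"] by (auto simp: inv_def c_def split: prod.splits)
  have c_mono: "i \<le> j \<Longrightarrow> c i \<le> c j" for i j by (rule lift_Suc_mono_le) (simp_all add: c_Suc less_imp_le)
  have c_ge: "j \<le> c j" for j
  proof (induction j)
    case (Suc j) then show ?case using c_Suc[of j] by linarith
  qed simp
  have frozen: "a j m = a i m" if "m < c (Suc i)" "i \<le> j" for i j m
    using that(2)
  proof (induction j rule: dec_induct)
    case (step j)
    have "m < c (Suc j)" using that(1) c_mono[of "Suc i" "Suc j"] step by simp
    then show ?case using frozen1 step by simp
  qed simp
  have str1: "stronger (a j m) (a (Suc j) m)" for j m
    using f_ge(1)[of j m] frozen1[of m j] by (cases "m < c (Suc j)") auto
  have str: "stronger (a i m) (a j m)" if "i \<le> j" for i j m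
    using that by (induction j rule: dec_induct) (auto intro: stronger_trans str1)
  \<comment> \<open>The diagonal is a limit: \<open>c j\<close> is at least \<open>j\<close>, so
    level \<open>m\<close> is frozen from step \<open>m\<close> on.\<close>
  define q where "q m = a m m" for m
  have q_eq: "q m = a j m" if "j \<ge> m" for j m
    using frozen[of m m j] that c_ge[of "Suc m"] by (simp add: q_def)
  have q_str: "stronger (a j m) (q m)" for j m
  proof (cases "j \<ge> m")
    case True then show ?thesis by (subst q_eq[OF True]) simp
  next
    case False then show ?thesis using str[of j m m] by (simp add: q_def)
  qed
  \<comment> \<open>At each step a level is either frozen or receives the norm demanded at that
    step, and the demand only grows.\<close>
  have nrm_a: "nrm H (\<pi> m) (a j m) \<ge> real Z" if m: "m \<ge> c (Suc Z)" and "j \<ge> Suc Z" for Z j m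
    using that(2)
  proof (induction j rule: dec_induct)
    case base then show ?case using f_ge(2) m by blast
  next
    case (step j)
    show ?case
    proof (cases "m < c (Suc j)")
      case True then show ?thesis using frozen1 step by simp
    next
      case False
      then have "nrm H (\<pi> m) (a (Suc j) m) \<ge> real j" using f_ge(2)[of j m] by simp
      then show ?thesis using step by simp
    qed
  qed
  have q_lim: "tends H \<pi> q" unfolding tends_iff
  proof
    fix Z :: real
    obtain K where K: "Z \<le> real K" using real_arch_simple by blast
    have "Z \<le> nrm H (\<pi> m) (q m)" if "m \<ge> c (Suc K)" for m
      using nrm_a[OF that, of m] that c_ge[of "Suc K"] K by (simp add: q_def)
    then show "\<exists>N. \<forall>m\<ge>N. Z \<le> nrm H (\<pi> m) (q m)" by blast
  qed
  have q_valid: "valid H \<pi> w0 q" using v0 ok q_lim by (auto simp: valid_def q_def)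
  have q_ext: "ext w0 a0 w0 q" using q_str[of 0] by (auto simp: ext_def a_def \<sigma>_0 run_Nil)
  have main: "\<exists>y\<in>A. \<exists>u' e'. valid H \<pi> u' e' \<and> ext u e u' e' \<and> D t y u' e'"
    if t: "t \<in> lists A" and u: "valid H \<pi> u e" "ext w0 q u e" and y: "y \<in> X" "D t y u e" for t u e y
  proof -
    obtain N where N: "\<forall>m\<ge>N. nrm H (\<pi> m) (e m) \<ge> 2" using u(1) unfolding valid_def tends_iff by blast
    obtain j where j: "j \<ge> max N (length u)" "s j = t" using s_inf[OF t] by blast
    have cj: "c (Suc j) \<ge> max N (length u)" using j c_ge[of "Suc j"] by simp
    then obtain u' where u': "valid H \<pi> u' e" "ext u e u' e" "length u' = c (Suc j)"
      using extend_stem[OF u(1), of "c (Suc j)"] by auto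
    have Dy: "D t y u' e" using decision_mono[OF D u(1) u'(1) u'(2)] y(2) by blast
    have u'seq: "u' \<in> seqs (H \<circ> \<pi>) (c (Suc j))" using u' by (simp add: valid_def)
    have "ext w0 q u' e" using u(2) u'(2) by (rule ext_trans)
    then have es: "stronger (a (Suc j) m) (e m)" if "m \<ge> c (Suc j)" for m
      using that q_str[of "Suc j" m] u'(3) stronger_trans[of "a (Suc j) m" "q m" "e m"]
      unfolding ext_def by simp
    \<comment> \<open>\<open>e\<close> itself is a pure extension of step \<open>Suc j\<close> under
      the stem \<open>u'\<close> that decides, and its norms exceed 1 because \<open>u'\<close>
      reaches beyond \<open>N\<close>. So the value recorded for \<open>u'\<close> is
      genuine.\<close>
    have "\<not> undecidable \<pi> (D t) X u' (a (Suc j))"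
    proof -
      have "nrm H (\<pi> m) (e m) > 1" if "m \<ge> length u'" for m 
      proof -
        have "nrm H (\<pi> m) (e m) \<ge> 2" using N that u'(3) cj by simp
        then show ?thesis by simp
      qed
      then show ?thesis unfolding undecidable_def using u'(1,3) es Dy y(1) by auto
    qed
    then have yv: "v (Suc j) u' \<in> X" "D t (v (Suc j) u') u' (a (Suc j))"
      using f_dec[OF u'seq] j(2) by auto
    have "valid H \<pi> u' (a (Suc j))" using u'seq u'(3) ok c0[of "Suc j"] inv[of "\<sigma> (Suc j)"]
      by (auto simp: valid_def inv_def a_def split: prod.splits)
    moreover have "ext u' (a (Suc j)) u' e" using es u'(3) by (auto simp: ext_def)
    ultimately have "D t (v (Suc j) u') u' e" using decision_mono[OF D _ u'(1)] yv(2) by blast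
    moreover have "v (Suc j) u' \<in> A" using val[OF \<sigma>A, of "Suc j" u'] yv(1) by (simp add: v_def)
    ultimately show ?thesis using u' by blast
  qed
  show ?thesis
  proof (intro bexI[of _ A] exI[of _ q] conjI ballI allI impI q_valid q_ext A(1))
    fix t u e assume "t \<in> lists A" "valid H \<pi> u e" "ext w0 q u e" "\<exists>y\<in>X. D t y u e"
    then show "\<exists>y\<in>A. \<exists>u' e'. valid H \<pi> u' e' \<and> ext u e u' e' \<and> D t y u' e'"
      using main by (elim bexE)
  qed
qed

section \<open>Preservation of stationary sets\<close>

lemma decision_f_mem:
  assumes "strict_mono \<pi>"
  shows "decision \<pi> (\<lambda>w a. f_mem (Q_of H \<pi>) x \<tau> (cnd H \<pi> w a))"
  unfolding decision_def
proof (intro conjI allI impI)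
  fix w a w' a'
  assume "valid H \<pi> w a" "valid H \<pi> w' a'" "ext w a w' a'" "f_mem (Q_of H \<pi>) x \<tau> (cnd H \<pi> w a)"
  moreover from this have "cnd H \<pi> w a \<in> conds (Q_of H \<pi>)" "cnd H \<pi> w' a' \<in> conds (Q_of H \<pi>)"
    unfolding conds_Q_of by blast+
  ultimately show "f_mem (Q_of H \<pi>) x \<tau> (cnd H \<pi> w' a')"
    using f_mem_mono[OF forcing_notion_Q_of[OF assms], of "cnd H \<pi> w a" "cnd H \<pi> w' a'" x \<tau>]
    by (simp add: le_cnd_iff)
next
  fix w a
  assume v: "valid H \<pi> w a" and *: "\<forall>u e. valid H \<pi> u e \<longrightarrow> ext w a u e \<longrightarrow>
    (\<exists>u' e'. valid H \<pi> u' e' \<and> ext u e u' e' \<and> f_mem (Q_of H \<pi>) x \<tau> (cnd H \<pi> u' e'))"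
  show "f_mem (Q_of H \<pi>) x \<tau> (cnd H \<pi> w a)"
  proof (rule f_mem_dense[OF forcing_notion_Q_of[OF assms]])
    show "cnd H \<pi> w a \<in> conds (Q_of H \<pi>)" using v unfolding conds_Q_of by blast
  next
    fix q assume q: "q \<in> conds (Q_of H \<pi>)" "le (Q_of H \<pi>) (cnd H \<pi> w a) q"
    obtain u e where u: "q = cnd H \<pi> u e" "valid H \<pi> u e" using q(1) unfolding conds_Q_of by blast
    have "ext w a u e" using q(2) v u by (simp add: le_cnd_iff)
    then obtain u' e' where "valid H \<pi> u' e'" "ext u e u' e'" "f_mem (Q_of H \<pi>) x \<tau> (cnd H \<pi> u' e')"
      using * u(2) by blast
    then show "\<exists>r\<in>conds (Q_of H \<pi>). le (Q_of H \<pi>) q r \<and> f_mem (Q_of H \<pi>) x \<tau> r"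
      using u unfolding conds_Q_of by (intro bexI[of _ "cnd H \<pi> u' e'"]) (simp add: le_cnd_iff, blast)
  qed
qed

text \<open>\<open>good\<close> provides unboundedly many lengths at which all stems can be treated
  at a total cost of 1. The fused condition does not decide the values of the name outright; it only
  makes values in \<open>A\<close> dense below itself, which is what \<open>f_ex\<close> asks
  for.\<close>

theorem proper_Q_of:
  assumes \<pi>: "strict_mono \<pi>"
    and good: "\<And>N. \<exists>c\<ge>N. \<forall>m\<ge>c. card (seqs (H \<circ> \<pi>) c) \<le> k_of H (\<pi> m)"
  shows "proper_forcing TYPE('x) (Q_of H \<pi>)"
proof -
  let ?P = "Q_of H \<pi>"
  have "f_stationary ?P X S p" if X: "uncountable X" "stationary X S" and p: "p \<in> conds ?P"
    for X :: "'x set" and S p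
    unfolding f_stationary_def f_all_def f_imp_def
  proof (intro ballI impI)
    fix F p' assume p': "p' \<in> conds ?P" and fn: "f_function ?P F (lists X) X p'"
    have tot: "\<exists>r\<in>conds ?P. le ?P q r \<and> (\<exists>y\<in>X. f_mem ?P (s, y) F r)"
      if "s \<in> lists X" "q \<in> conds ?P" "le ?P p' q" for s q
      using fn that unfolding f_function_def f_and_def f_all_def f_ex_def by blast
    show "f_ex ?P S (\<lambda>A. \<lambda>p. \<forall>s\<in>lists A. f_ex ?P A (\<lambda>y. f_mem ?P (s, y) F) p) p'"
      unfolding f_ex_def[of ?P S]
    proof (intro ballI impI)
      fix q assume q: "q \<in> conds ?P" "le ?P p' q"
      then obtain w0 a0 where wa: "q = cnd H \<pi> w0 a0" "valid H \<pi> w0 a0" unfolding conds_Q_of by blast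
      obtain A r where A: "A \<in> S" and r: "valid H \<pi> w0 r" "ext w0 a0 w0 r" and
        dec: "\<And>s u e y. s \<in> lists A \<Longrightarrow> valid H \<pi> u e \<Longrightarrow> ext w0 r u e \<Longrightarrow> y \<in> X \<Longrightarrow>
          f_mem ?P (s, y) F (cnd H \<pi> u e) \<Longrightarrow>
          \<exists>y\<in>A. \<exists>u' e'. valid H \<pi> u' e' \<and> ext u e u' e' \<and> f_mem ?P (s, y) F (cnd H \<pi> u' e')"
        using fusion[OF decision_f_mem[OF \<pi>] good X wa(2), of "\<lambda>s y. (s, y)" "\<lambda>s y. F"] by blast
      have AX: "lists A \<subseteq> lists X" using A X(2) unfolding stationary_def ctbl_subsets_def
        by (intro lists_mono) auto
      have rc: "cnd H \<pi> w0 r \<in> conds ?P" "le ?P q (cnd H \<pi> w0 r)"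
        using r wa unfolding conds_Q_of by (auto simp: le_cnd_iff)
      have "f_ex ?P A (\<lambda>y. f_mem ?P (s, y) F) (cnd H \<pi> w0 r)" if s: "s \<in> lists A" for s
        unfolding f_ex_def
      proof (intro ballI impI)
        fix t assume t: "t \<in> conds ?P" "le ?P (cnd H \<pi> w0 r) t"
        note tr = forcing_notion_trans[OF forcing_notion_Q_of[OF \<pi>]]
        have "le ?P p' t" using tr[OF p' q(1) t(1) q(2)] tr[OF q(1) rc(1) t(1) rc(2) t(2)] by blast
        then obtain t' y where t': "t' \<in> conds ?P" "le ?P t t'" "y \<in> X" "f_mem ?P (s, y) F t'"
          using tot[of s t] s AX t(1) by blast
        then obtain u e where u: "t' = cnd H \<pi> u e" "valid H \<pi> u e" unfolding conds_Q_of by blast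
        have "ext w0 r u e" using tr[OF rc(1) t(1) t'(1) t(2) t'(2)] u r by (simp add: le_cnd_iff)
        then obtain y' u' e' where *: "y' \<in> A" "valid H \<pi> u' e'" "ext u e u' e'" "f_mem ?P (s, y') F (cnd H \<pi> u' e')"
          using dec[OF s u(2)] t'(3,4) u(1) by blast
        have "cnd H \<pi> u' e' \<in> conds ?P" using * unfolding conds_Q_of by blast
        moreover have "le ?P t' (cnd H \<pi> u' e')" using * u by (simp add: le_cnd_iff)
        ultimately show "\<exists>r\<in>conds ?P. le ?P t r \<and> (\<exists>y\<in>A. f_mem ?P (s, y) F r)"
          using * tr[OF t(1) t'(1)] t'(2) by blast
      qed
      then show "\<exists>r\<in>conds ?P. le ?P q r \<and> (\<exists>A\<in>S. \<forall>s\<in>lists A. f_ex ?P A (\<lambda>y. f_mem ?P (s, y) F) r)"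
        using rc A by blast
    qed
  qed
  then show ?thesis unfolding proper_forcing_def forced_def using forcing_notion_Q_of[OF \<pi>] by blast
qed

end

section \<open>The specific levels\<close>

text \<open>Kept folded, since the simplifier would evaluate the numeral.\<close>

definition threshold :: nat where
  "threshold = 2 ^ (2 ^ 16)"

lemma log2_log2_power: "log 2 (log 2 (real (2 ^ (2 ^ m)))) = real m"
  by simp

lemma log2_log2_threshold: "log 2 (log 2 (real threshold)) = 16"
  unfolding threshold_def log2_log2_power by simp

lemma threshold_ge_2: "threshold \<ge> 2"
  unfolding threshold_def by (rule self_le_power) simp_all

lemma k_of_threshold: "k_of H n = (if l_of H n > threshold
    then nat \<lfloor>sqrt (real (Max {k. k > 0 \<and> f_norm k (real (l_of H n)) 0 > 1}))\<rfloor> else 2)"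
  by (simp only: k_of_def threshold_def)

text \<open>\<open>k\<close> is the integer part of the root of the largest integer below
  \<open>y\<close>, which puts \<open>y\<close> between two consecutive squares. The threshold is
  where \<open>y\<close> passes 4, and this gives \<open>k \<ge> 2\<close>.\<close>

lemma k_of_large:
  assumes "l_of H n > threshold"
  defines "y \<equiv> log 2 (log 2 (log 2 (real (l_of H n))))"
  shows "real (k_of H n) ^ 2 < y" "y \<le> (real (k_of H n) + 1) ^ 2" "k_of H n \<ge> 2" "y > 4"
    "log 2 (log 2 (real (l_of H n))) > 16" "log 2 (real (l_of H n)) > 1"
    "f_norm k (real (l_of H n)) 0 = y / real k"
proof -
  define x where "x = real (l_of H n)"
  have x: "x > real threshold" using assms(1) by (simp add: x_def)
  have "log 2 (real threshold) \<ge> 1" using threshold_ge_2 by (simp add: le_log_iff)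
  moreover have "log 2 x > log 2 (real threshold)" using x threshold_ge_2 by simp
  ultimately have x1: "log 2 x > 1" "log 2 (log 2 x) > 16"
    using log2_log2_threshold log_less_cancel_iff[of 2 "log 2 (real threshold)" "log 2 x"] by linarith+
  then show "log 2 (log 2 (real (l_of H n))) > 16" "log 2 (real (l_of H n)) > 1" by (simp_all add: x_def)
  have "log 2 (log 2 (log 2 x)) > log 2 (2 powr 4)" using x1 by (subst log_less_cancel_iff) auto
  moreover have "log 2 (2 powr 4) = (4::real)" by (rule log_powr_cancel) simp_all
  ultimately show y4: "y > 4" by (simp only: y_def x_def)
  have f: "f_norm k x 0 = y / real k" for k
  proof -
    have "2 powr 1 \<le> log 2 x" by (rule iffD1[OF le_log_iff]) (use x1 in linarith)+
    then show ?thesis using x x1 y4 by (simp add: f_norm_def y_def x_def)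
  qed
  then show "f_norm k (real (l_of H n)) 0 = y / real k" by (simp add: x_def)
  let ?K = "{k. k > 0 \<and> f_norm k x 0 > 1}"
  have K: "?K = {k. 0 < k \<and> real k < y}" by (auto simp: f)
  have "?K \<subseteq> {..nat \<lceil>y\<rceil>}" unfolding K by (auto simp: le_nat_iff) linarith
  then have finK: "finite ?K" by (rule finite_subset) simp
  have 4: "4 \<in> ?K" unfolding K using y4 by simp
  then have "?K \<noteq> {}" by blast
  then have K0: "Max ?K \<in> ?K" "4 \<le> Max ?K" using finK 4 Max_in[of ?K] Max_ge[of ?K 4] by blast+
  have "Suc (Max ?K) \<notin> ?K" using Max_ge[OF finK, of "Suc (Max ?K)"] by linarith
  then have K1: "y \<le> real (Max ?K) + 1" unfolding K by auto
  have k: "k_of H n = nat \<lfloor>sqrt (real (Max ?K))\<rfloor>" using assms(1) by (simp add: k_of_threshold x_def)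
  have s: "real (k_of H n) \<le> sqrt (real (Max ?K))" "sqrt (real (Max ?K)) < real (k_of H n) + 1"
    unfolding k by (auto simp: of_nat_nat)
  have "real (k_of H n) ^ 2 \<le> sqrt (real (Max ?K)) ^ 2" using s(1) by (intro power_mono) auto
  then have "real (k_of H n) ^ 2 \<le> real (Max ?K)" by simp
  moreover have "real (Max ?K) < y" using K0(1) unfolding K by simp
  ultimately show "real (k_of H n) ^ 2 < y" by linarith
  have "sqrt (real (Max ?K)) ^ 2 < (real (k_of H n) + 1) ^ 2" using s(2) by (intro power_strict_mono) auto
  then have "real (Max ?K) < real ((k_of H n + 1) ^ 2)" by (simp add: ac_simps)
  \<comment> \<open>Strictness between integers regains the 1 that is lost in \<open>K1\<close> by
    passing from \<open>y\<close> to \<open>Max ?K\<close>.\<close>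
  then have "Suc (Max ?K) \<le> (k_of H n + 1) ^ 2" by (simp only: of_nat_less_iff Suc_le_eq)
  then have "real (Suc (Max ?K)) \<le> real ((k_of H n + 1) ^ 2)" by (simp only: of_nat_le_iff)
  then have "1 + real (Max ?K) \<le> (real (k_of H n) + 1) ^ 2"
    by (simp only: of_nat_Suc of_nat_power of_nat_add of_nat_1)
  then show "y \<le> (real (k_of H n) + 1) ^ 2" using K1 by linarith
  have "sqrt 4 \<le> sqrt (real (Max ?K))" using K0(2) by (intro real_sqrt_le_mono) simp
  then have "2 < real (k_of H n) + 1" using s(2) by simp
  then show "k_of H n \<ge> 2" by simp
qed

lemma k_of_small: "l_of H n \<le> threshold \<Longrightarrow> k_of H n = 2"
  by (simp add: k_of_threshold)

lemma k_of_ge_2: "k_of H n \<ge> 2"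
  using k_of_small[of H n] k_of_large(3)[of H n] by (cases "l_of H n \<le> threshold") auto

lemma k_of_mono:
  assumes "l_of H n \<le> l_of H m"
  shows "k_of H n \<le> k_of H m"
proof (cases "l_of H n > threshold")
  case True
  then have m: "l_of H m > threshold" using assms by (rule less_le_trans)
  have "log 2 (real (l_of H n)) \<le> log 2 (real (l_of H m))" using assms True by simp
  then have "log 2 (log 2 (real (l_of H n))) \<le> log 2 (log 2 (real (l_of H m)))"
    using k_of_large(6)[OF True] by simp
  then have "log 2 (log 2 (log 2 (real (l_of H n)))) \<le> log 2 (log 2 (log 2 (real (l_of H m))))"
    using k_of_large(5)[OF True] by simp
  then have "real (k_of H n) ^ 2 < (real (k_of H m) + 1) ^ 2"
    using k_of_large(1)[OF True] k_of_large(2)[OF m] by linarith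
  then have "real (k_of H n) < real (k_of H m) + 1" by (rule power_less_imp_less_base) simp
  then show ?thesis by simp
next
  case False
  then show ?thesis using k_of_small[of H n] k_of_ge_2[of H m] by simp
qed

locale level_sizes =
  fixes mbar :: "nat \<Rightarrow> nat"
  assumes mono: "strict_mono mbar" and zero: "mbar 0 = 0"
begin

abbreviation "H \<equiv> H_of mbar"

lemma ex_block: "\<exists>i. mbar i \<le> j \<and> j < mbar (Suc i)"
proof -
  have "j < mbar (Suc j)" using strict_mono_imp_increasing[OF mono, of "Suc j"] by simp
  then obtain k where k: "j < mbar k" "\<forall>i<k. \<not> j < mbar i" using exists_least_iff[of "\<lambda>k. j < mbar k"] by blast
  then have "k \<noteq> 0" using zero by (cases k) auto
  then obtain i where "k = Suc i" by (cases k) auto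
  then show ?thesis using k by (intro exI[of _ i]) auto
qed

lemma block_unique:
  assumes "mbar i \<le> j" "j < mbar (Suc i)" "mbar i' \<le> j" "j < mbar (Suc i')"
  shows "i = i'"
proof -
  have "mbar i < mbar (Suc i')" "mbar i' < mbar (Suc i)" using assms by linarith+
  then show ?thesis using mono by (simp add: strict_mono_less)
qed

lemma H_block: assumes "mbar i \<le> j" "j < mbar (Suc i)" shows "H j = {..<i + 2}"
proof -
  have "(THE i. mbar i \<le> j \<and> j < mbar (Suc i)) = i"
    using assms block_unique by (intro the_equality) blast+
  then show ?thesis by (simp add: H_of_def)
qed

lemma l_block: "mbar i \<le> j \<Longrightarrow> j < mbar (Suc i) \<Longrightarrow> l_of H j = i + 2"
  by (simp add: l_of_def H_block)

lemma l_mono: assumes "n \<le> m" shows "l_of H n \<le> l_of H m"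
proof -
  obtain i i' where i: "mbar i \<le> n" "n < mbar (Suc i)" "mbar i' \<le> m" "m < mbar (Suc i')"
    using ex_block by meson
  then have "mbar i < mbar (Suc i')" using assms by linarith
  then show ?thesis using mono i by (simp add: strict_mono_less l_block)
qed

lemma l_ge: "mbar i \<le> n \<Longrightarrow> i + 2 \<le> l_of H n"
  using l_mono[of "mbar i" n] l_block[of i "mbar i"] mono by (simp add: strict_mono_less)

lemma k_mono: "n \<le> m \<Longrightarrow> k_of H n \<le> k_of H m"
  by (intro k_of_mono l_mono)

lemma full_norm: "\<exists>N. \<forall>n\<ge>N. Z \<le> f_norm (k_of H n) (real (l_of H n)) 0"
proof -
  \<comment> \<open>Beyond \<open>c\<close> the threefold logarithm is at least
    \<open>Z ^ 2\<close>. As \<open>k\<close> is at most its square root, the quotient of the two is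
    at least \<open>Z\<close>.\<close>
  define c where "c = 2 powr (2 powr (2 powr (Z ^ 2)))"
  obtain i where i: "real i \<ge> max c (real threshold)" using real_arch_simple by blast
  have "Z \<le> f_norm (k_of H n) (real (l_of H n)) 0" if "mbar i \<le> n" for n
  proof -
    have l: "real (l_of H n) > real threshold" "real (l_of H n) \<ge> c" using l_ge[OF that] i by linarith+
    then have big: "l_of H n > threshold" by simp
    have "log 2 (real (l_of H n)) \<ge> 2 powr (2 powr (Z ^ 2))"
      using l big unfolding c_def by (subst le_log_iff) auto
    then have "log 2 (log 2 (real (l_of H n))) \<ge> 2 powr (Z ^ 2)"
      using k_of_large(6)[OF big] by (subst le_log_iff) auto
    then have y: "log 2 (log 2 (log 2 (real (l_of H n)))) \<ge> Z ^ 2" (is "?y \<ge> _")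
      using k_of_large(5)[OF big] by (subst le_log_iff) auto
    have y4: "?y > 4" by (rule k_of_large(4)[OF big])
    have k: "real (k_of H n) \<le> sqrt ?y" using k_of_large(1)[OF big] by (intro real_le_rsqrt) simp
    have "\<bar>Z\<bar> \<le> sqrt ?y" using y by (intro real_le_rsqrt) simp
    then have "Z * real (k_of H n) \<le> sqrt ?y * sqrt ?y" using k y4 by (intro mult_mono) auto
    then have "Z * real (k_of H n) \<le> ?y" using y4 by simp
    then show ?thesis unfolding k_of_large(7)[OF big] using k_of_ge_2[of H n] by (simp add: field_simps)
  qed
  then show ?thesis by blast
qed

sublocale creature_forcing H
proof
  fix n
  obtain i where i: "mbar i \<le> n" "n < mbar (Suc i)" using ex_block by blast
  show "finite (H n)" "card (H n) \<ge> 2" using i by (simp_all add: H_block)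
  show "k_of H n \<ge> 1" using k_of_ge_2[of H n] by simp
next
  show "filterlim (\<lambda>n. f_norm (k_of H n) (real (l_of H n)) 0) at_top sequentially"
    unfolding filterlim_at_top eventually_sequentially using full_norm by blast
qed

end

section \<open>Enumerations of the two sets of levels\<close>

lemma infinite_U_of:
  assumes "strict_mono nbar"
  shows "infinite (U_of nbar l)"
  unfolding infinite_nat_iff_unbounded_le
proof
  fix m
  have "m \<le> nbar (2 * m + l)" using strict_mono_imp_increasing[OF assms, of "2 * m + l"] by simp
  moreover have "nbar (2 * m + l) \<in> U_of nbar l" using assms unfolding U_of_def strict_mono_less
    by (intro UN_I[of m]) (auto simp: strict_mono_less)
  ultimately show "\<exists>n\<ge>m. n \<in> U_of nbar l" by blast
qed

lemma strict_mono_pi_of: "strict_mono nbar \<Longrightarrow> strict_mono (pi_of nbar l)"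
  unfolding pi_of_def by (intro strict_mono_enumerate infinite_U_of)

lemma range_pi_of: "strict_mono nbar \<Longrightarrow> range (pi_of nbar l) = U_of nbar l"
  unfolding pi_of_def by (intro range_enumerate infinite_U_of)

lemma pi_of_below_block:
  assumes "strict_mono nbar" "pi_of nbar l m < nbar (2 * i + l)"
  shows "pi_of nbar l m < nbar (2 * i + l - 1)"
proof -
  have "pi_of nbar l m \<in> U_of nbar l" using range_pi_of[OF assms(1), of l] by blast
  then obtain i' where i': "nbar (2 * i' + l) \<le> pi_of nbar l m" "pi_of nbar l m < nbar (2 * i' + l + 1)"
    by (auto simp: U_of_def)
  then have "nbar (2 * i' + l) < nbar (2 * i + l)" using assms(2) by linarith
  then have "2 * i' + l + 1 \<le> 2 * i + l - 1" using assms(1) by (simp add: strict_mono_less)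
  then have "nbar (2 * i' + l + 1) \<le> nbar (2 * i + l - 1)" using assms(1) by (simp add: strict_mono_less_eq)
  then show ?thesis using i'(2) by linarith
qed

context creature_forcing
begin

lemma card_seqs_le: "card (seqs (H \<circ> \<pi>) c) \<le> (\<Prod>m<c. card (H (\<pi> m)))"
proof (induction c)
  case 0
  have "seqs (H \<circ> \<pi>) 0 = {[]}" by (auto simp: seqs_def)
  then show ?case by (simp del: o_apply)
next
  case (Suc c)
  have "seqs (H \<circ> \<pi>) (Suc c) \<subseteq> (\<lambda>(u, x). u @ [x]) ` (seqs (H \<circ> \<pi>) c \<times> H (\<pi> c))"
  proof
    fix v assume v: "v \<in> seqs (H \<circ> \<pi>) (Suc c)"
    then have "v = take c v @ [v ! c]" by (auto simp: seqs_def take_Suc_conv_app_nth[symmetric])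
    moreover have "(take c v, v ! c) \<in> seqs (H \<circ> \<pi>) c \<times> H (\<pi> c)" using v by (auto simp: seqs_def)
    ultimately show "v \<in> (\<lambda>(u, x). u @ [x]) ` (seqs (H \<circ> \<pi>) c \<times> H (\<pi> c))" by force
  qed
  then have "card (seqs (H \<circ> \<pi>) (Suc c)) \<le> card (seqs (H \<circ> \<pi>) c \<times> H (\<pi> c))"
    using finite_seqs fin_H by (intro surj_card_le) auto
  also have "\<dots> \<le> (\<Prod>m<Suc c. card (H (\<pi> m)))" using Suc.IH
    by (simp add: card_cartesian_product del: o_apply)
  finally show ?case .
qed

end

context level_sizes
begin

lemma good_lengths:
  assumes nbar: "strict_mono nbar"
    and large: "\<And>i. k_of H (nbar (Suc i)) \<ge> 2 * (\<Prod>j<nbar i. card (H j))"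
  shows "\<exists>c\<ge>N. \<forall>m\<ge>c. card (seqs (H \<circ> pi_of nbar l) c) \<le> k_of H (pi_of nbar l m)"
proof -
  let ?\<pi> = "pi_of nbar l"
  have sm: "strict_mono ?\<pi>" using nbar by (rule strict_mono_pi_of)
  \<comment> \<open>Large enough to pass \<open>?\<pi> N\<close>; the \<open>Suc\<close> also makes
    the subtraction in \<open>s\<close> a true one, so that the interval starting at
    \<open>nbar s\<close> is the one of the other set just below.\<close>
  define i where "i = Suc (?\<pi> N)"
  define s where "s = 2 * i + l - 1"
  have s: "Suc s = 2 * i + l" by (simp add: s_def i_def)
  have "nbar (2 * i + l) \<in> U_of nbar l" using nbar unfolding U_of_def
    by (intro UN_I[of i]) (auto simp: strict_mono_less)
  then obtain c where c: "?\<pi> c = nbar (2 * i + l)" using range_pi_of[OF nbar, of l] by (metis imageE)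
  have "?\<pi> N \<le> ?\<pi> c" unfolding c using strict_mono_imp_increasing[OF nbar, of "2 * i + l"]
    by (simp add: i_def)
  then have "N \<le> c" using sm by (simp add: strict_mono_less_eq)
  moreover have "card (seqs (H \<circ> ?\<pi>) c) \<le> k_of H (?\<pi> m)" if "m \<ge> c" for m
  proof -
    have "card (seqs (H \<circ> ?\<pi>) c) \<le> (\<Prod>m<c. card (H (?\<pi> m)))" by (rule card_seqs_le)
    also have "\<dots> = (\<Prod>j\<in>?\<pi> ` {..<c}. card (H j))"
      using strict_mono_imp_inj_on[OF sm] by (subst prod.reindex) (auto intro: inj_on_subset)
    also have "\<dots> \<le> (\<Prod>j<nbar s. card (H j))"
    proof (intro dvd_imp_le prod_dvd_prod_subset subsetI)
      fix j assume "j \<in> ?\<pi> ` {..<c}"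
      then obtain m where m: "j = ?\<pi> m" "m < c" by auto
      then have "?\<pi> m < ?\<pi> c" using sm by (simp add: strict_mono_less)
      with m(1) c have "j = ?\<pi> m" "?\<pi> m < nbar (2 * i + l)" by simp_all
      then show "j \<in> {..<nbar s}" using pi_of_below_block[OF nbar, of l m i] by (simp add: s_def)
    next
      show "0 < (\<Prod>j<nbar s. card (H j))" using card_H by (intro prod_pos ballI) (metis less_le_trans zero_less_numeral)
    qed simp
    also have "\<dots> \<le> k_of H (nbar (Suc s))" using large[of s] by simp
    also have "\<dots> = k_of H (?\<pi> c)" by (simp add: c s)
    also have "\<dots> \<le> k_of H (?\<pi> m)" using sm that by (intro k_mono) (simp add: strict_mono_less_eq)
    finally show ?thesis .
  qed
  ultimately show ?thesis by blast
qed

lemma proper_Q_of_pi_of: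
  assumes "strict_mono nbar"
    and "\<And>i. k_of H (nbar (Suc i)) \<ge> 2 * (\<Prod>j<nbar i. card (H j))"
  shows "proper_forcing TYPE('x) (Q_of H (pi_of nbar l))"
  using assms by (intro proper_Q_of strict_mono_pi_of good_lengths)

end

section \<open>Splitting the levels into two sets\<close>

text \<open>For increasing \<open>\<pi>\<close> this is the length of the trace that a stem of
  length \<open>N\<close> leaves on \<open>range \<pi>\<close>.\<close>

definition below :: "(nat \<Rightarrow> nat) \<Rightarrow> nat \<Rightarrow> nat" where
  "below \<pi> N = card {m. \<pi> m < N}"

lemma below_iff:
  assumes "strict_mono \<pi>"
  shows "m < below \<pi> N \<longleftrightarrow> \<pi> m < N"
proof -
  have "{m. \<pi> m < N} \<subseteq> {..<N}" using strict_mono_imp_increasing[OF assms] by (auto intro: le_less_trans)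
  then have fin: "finite {m. \<pi> m < N}" by (rule finite_subset) simp
  define c where "c = (LEAST c. \<not> \<pi> c < N)"
  have "\<not> \<pi> N < N" using strict_mono_imp_increasing[OF assms, of N] by simp
  then have c: "\<not> \<pi> c < N" unfolding c_def by (rule LeastI)
  have "{m. \<pi> m < N} = {..<c}"
  proof (intro equalityI subsetI)
    fix m assume "m \<in> {m. \<pi> m < N}"
    then have "\<pi> m < \<pi> c" using c by simp
    then show "m \<in> {..<c}" using assms by (simp add: strict_mono_less)
  next
    fix m assume "m \<in> {..<c}"
    then show "m \<in> {m. \<pi> m < N}" unfolding c_def using not_less_Least by force
  qed
  then have "below \<pi> N = c" "\<forall>m. \<pi> m < N \<longleftrightarrow> m < c" unfolding below_def by auto
  then show ?thesis by simp
qed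

definition restr :: "(nat \<Rightarrow> nat) \<Rightarrow> nat list \<Rightarrow> nat list" where
  "restr \<pi> w = map (\<lambda>m. w ! \<pi> m) [0..<below \<pi> (length w)]"

lemma length_restr [simp]: "length (restr \<pi> w) = below \<pi> (length w)"
  by (simp add: restr_def)

lemma nth_restr: "m < below \<pi> (length w) \<Longrightarrow> restr \<pi> w ! m = w ! \<pi> m"
  by (simp add: restr_def)

lemma prefix_iff_nth: "prefix u v \<longleftrightarrow> length u \<le> length v \<and> (\<forall>m<length u. v ! m = u ! m)"
proof
  assume r: "length u \<le> length v \<and> (\<forall>m<length u. v ! m = u ! m)"
  then have "take (length u) v = u" by (intro nth_equalityI) auto
  then show "prefix u v" by (metis take_is_prefix)
qed (auto simp: prefix_def nth_append)

locale splitting =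
  fixes \<pi>0 \<pi>1 :: "nat \<Rightarrow> nat"
  assumes mono0: "strict_mono \<pi>0" and mono1: "strict_mono \<pi>1"
    and disj: "range \<pi>0 \<inter> range \<pi>1 = {}" and cover: "range \<pi>0 \<union> range \<pi>1 = UNIV"
begin

lemma split_all: "(\<forall>n. P n) \<longleftrightarrow> (\<forall>m. P (\<pi>0 m)) \<and> (\<forall>m. P (\<pi>1 m))"
  using cover by (metis UNIV_I UnE imageE)

lemma merge: obtains g where "\<And>m. g (\<pi>0 m) = a m" "\<And>m. g (\<pi>1 m) = b m"
proof
  define g where "g n = (if n \<in> range \<pi>0 then a (inv \<pi>0 n) else b (inv \<pi>1 n))" for n
  note inj = strict_mono_imp_inj_on[OF mono0] strict_mono_imp_inj_on[OF mono1]
  show "g (\<pi>0 m) = a m" for m using inj by (simp add: g_def)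
  have "\<pi>1 m \<notin> range \<pi>0" for m using disj by blast
  then show "g (\<pi>1 m) = b m" for m using inj by (simp add: g_def)
qed

text \<open>Extension is a conjunction of conditions \<open>R n\<close> on single positions, and
  these distribute over the two ranges. Even the comparison of the lengths is written position by
  position for this purpose. \<open>valid_split_iff\<close> rests on the same idea.\<close>

lemma ext_split_iff:
  "ext w a w' a' \<longleftrightarrow> ext (restr \<pi>0 w) (a \<circ> \<pi>0) (restr \<pi>0 w') (a' \<circ> \<pi>0) \<and>
    ext (restr \<pi>1 w) (a \<circ> \<pi>1) (restr \<pi>1 w') (a' \<circ> \<pi>1)"
proof -
  define R where "R n \<longleftrightarrow> (n < length w \<longrightarrow> n < length w' \<and> w' ! n = w ! n) \<and>
    (length w \<le> n \<and> n < length w' \<longrightarrow> w' ! n \<in> fst (a n)) \<and>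
    (length w' \<le> n \<longrightarrow> stronger (a n) (a' n))" for n
  have 1: "ext w a w' a' \<longleftrightarrow> (\<forall>n. R n)"
  proof -
    have "length w \<le> length w' \<longleftrightarrow> (\<forall>n. n < length w \<longrightarrow> n < length w')"
      by (meson less_le_trans not_le order_refl)
    then show ?thesis unfolding ext_def prefix_iff_nth R_def by blast
  qed
  have 2: "ext (restr \<pi> w) (a \<circ> \<pi>) (restr \<pi> w') (a' \<circ> \<pi>) \<longleftrightarrow> (\<forall>m. R (\<pi> m))" if "strict_mono \<pi>" for \<pi>
  proof -
    have "below \<pi> (length w) \<le> below \<pi> (length w') \<longleftrightarrow> (\<forall>m. m < below \<pi> (length w) \<longrightarrow> m < below \<pi> (length w'))"
      by (meson less_le_trans not_le order_refl)
    moreover have "below \<pi> N \<le> m \<longleftrightarrow> N \<le> \<pi> m" for N m using below_iff[OF that, of m N] by linarith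
    ultimately show ?thesis unfolding ext_def prefix_iff_nth R_def length_restr
      by (auto simp: nth_restr below_iff[OF that])
  qed
  show ?thesis unfolding 1 2[OF mono0] 2[OF mono1] by (rule split_all)
qed

lemma tends_split_iff: "tends H id a \<longleftrightarrow> tends H \<pi>0 (a \<circ> \<pi>0) \<and> tends H \<pi>1 (a \<circ> \<pi>1)"
proof
  assume "tends H id a"
  then show "tends H \<pi>0 (a \<circ> \<pi>0) \<and> tends H \<pi>1 (a \<circ> \<pi>1)" unfolding tends_def comp_def id_def
    using filterlim_compose[OF _ filterlim_subseq[OF mono0]] filterlim_compose[OF _ filterlim_subseq[OF mono1]]
    by blast
next
  assume *: "tends H \<pi>0 (a \<circ> \<pi>0) \<and> tends H \<pi>1 (a \<circ> \<pi>1)"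
  show "tends H id a" unfolding tends_iff
  proof
    fix Z
    obtain N0 N1 where N: "\<forall>m\<ge>N0. nrm H (\<pi>0 m) (a (\<pi>0 m)) \<ge> Z" "\<forall>m\<ge>N1. nrm H (\<pi>1 m) (a (\<pi>1 m)) \<ge> Z"
      using * unfolding tends_iff comp_def by metis
    have "\<forall>n. n \<ge> max (\<pi>0 N0) (\<pi>1 N1) \<longrightarrow> nrm H n (a n) \<ge> Z"
      by (rule iffD2[OF split_all]) (use N mono0 mono1 in \<open>simp add: strict_mono_less_eq\<close>)
    then show "\<exists>N. \<forall>n\<ge>N. Z \<le> nrm H (id n) (a n)"
      by (intro exI[of _ "max (\<pi>0 N0) (\<pi>1 N1)"]) simp
  qed
qed

lemma valid_split_iff:
  "valid H id w a \<longleftrightarrow> valid H \<pi>0 (restr \<pi>0 w) (a \<circ> \<pi>0) \<and> valid H \<pi>1 (restr \<pi>1 w) (a \<circ> \<pi>1)"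
proof -
  define R where "R n \<longleftrightarrow> (n < length w \<longrightarrow> w ! n \<in> H n) \<and> (length w \<le> n \<longrightarrow> level_ok H n (a n))" for n
  have 1: "valid H id w a \<longleftrightarrow> (\<forall>n. R n) \<and> tends H id a"
    unfolding valid_def seqs_def R_def by auto
  have 2: "valid H \<pi> (restr \<pi> w) (a \<circ> \<pi>) \<longleftrightarrow> (\<forall>m. R (\<pi> m)) \<and> tends H \<pi> (a \<circ> \<pi>)" if "strict_mono \<pi>" for \<pi>
  proof -
    have "below \<pi> N \<le> m \<longleftrightarrow> N \<le> \<pi> m" for N m using below_iff[OF that, of m N] by linarith
    then show ?thesis unfolding valid_def seqs_def R_def length_restr
      by (auto simp: nth_restr below_iff[OF that])
  qed
  show ?thesis unfolding 1 2[OF mono0] 2[OF mono1] tends_split_iff using split_all[of R] by blast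
qed

end

section \<open>The isomorphism with a dense part of the product\<close>

locale split_forcing = creature_forcing + splitting
begin

abbreviation "P0 \<equiv> Q_of H \<pi>0"
abbreviation "P1 \<equiv> Q_of H \<pi>1"
abbreviation "PP \<equiv> prod_forcing P0 P1"

lemma conds_prod: "conds PP = {(cnd H \<pi>0 w0 a0, cnd H \<pi>1 w1 a1) | w0 a0 w1 a1. valid H \<pi>0 w0 a0 \<and> valid H \<pi>1 w1 a1}"
  by (auto simp: prod_forcing_def conds_Q_of)

lemma le_prod_iff:
  assumes "valid H \<pi>0 w0 a0" "valid H \<pi>1 w1 a1" "valid H \<pi>0 w0' a0'" "valid H \<pi>1 w1' a1'"
  shows "le PP (cnd H \<pi>0 w0 a0, cnd H \<pi>1 w1 a1) (cnd H \<pi>0 w0' a0', cnd H \<pi>1 w1' a1') \<longleftrightarrow>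
    ext w0 a0 w0' a0' \<and> ext w1 a1 w1' a1'"
  using assms by (simp add: prod_forcing_def le_cnd_iff)

text \<open>A pair comes from a single condition only if both stems end at the same absolute
  position. Both are therefore lengthened up to \<open>N\<close> and then interleaved; this is why
  one obtains a dense part of the product and not all of it.\<close>

lemma common_extension:
  assumes v: "valid H \<pi>0 w0 a0" "valid H \<pi>1 w1 a1" and N: "\<pi>0 (length w0) \<le> N" "\<pi>1 (length w1) \<le> N"
  obtains w a where "length w = N" "valid H id w a"
    "ext w0 a0 (restr \<pi>0 w) (a \<circ> \<pi>0)" "ext w1 a1 (restr \<pi>1 w) (a \<circ> \<pi>1)"
proof -
  have l: "length w0 \<le> below \<pi>0 N" "length w1 \<le> below \<pi>1 N"
    using N below_iff[OF mono0, of "below \<pi>0 N" N] below_iff[OF mono1, of "below \<pi>1 N" N]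
      mono0 mono1 by (auto simp: not_less intro: ccontr) (meson le_less_linear le_trans not_less strict_mono_less)+
  obtain u0 where u0: "valid H \<pi>0 u0 a0" "ext w0 a0 u0 a0" "length u0 = below \<pi>0 N"
    using extend_stem[OF v(1) l(1)] .
  obtain u1 where u1: "valid H \<pi>1 u1 a1" "ext w1 a1 u1 a1" "length u1 = below \<pi>1 N"
    using extend_stem[OF v(2) l(2)] .
  obtain a where a: "\<And>m. a (\<pi>0 m) = a0 m" "\<And>m. a (\<pi>1 m) = a1 m" using merge[of a0 a1] by blast
  obtain f where f: "\<And>m. f (\<pi>0 m) = u0 ! m" "\<And>m. f (\<pi>1 m) = u1 ! m"
    using merge[of "\<lambda>m. u0 ! m" "\<lambda>m. u1 ! m"] by blast
  define w where "w = map f [0..<N]"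
  have len: "length w = N" by (simp add: w_def)
  have r0: "restr \<pi>0 w = u0"
  proof (rule nth_equalityI)
    fix m assume "m < length (restr \<pi>0 w)"
    then have "\<pi>0 m < N" "m < below \<pi>0 N" using below_iff[OF mono0] len by auto
    then show "restr \<pi>0 w ! m = u0 ! m" by (simp add: nth_restr len f) (simp add: w_def f)
  qed (simp add: len u0)
  have r1: "restr \<pi>1 w = u1"
  proof (rule nth_equalityI)
    fix m assume "m < length (restr \<pi>1 w)"
    then have "\<pi>1 m < N" "m < below \<pi>1 N" using below_iff[OF mono1] len by auto
    then show "restr \<pi>1 w ! m = u1 ! m" by (simp add: nth_restr len f) (simp add: w_def f)
  qed (simp add: len u1)
  have c: "a \<circ> \<pi>0 = a0" "a \<circ> \<pi>1 = a1" using a by auto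
  show ?thesis
    by (rule that[of w a]) (use len u0 u1 in \<open>simp_all add: valid_split_iff r0 r1 c\<close>)
qed

text \<open>Reads the levels off the condition itself, so that \<open>split_cond\<close> depends on
  no choice of a representation. Below the stem the truncated subtraction yields values that do not
  matter.\<close>

definition levels :: "(nat, nat \<times> level) cond \<Rightarrow> nat \<Rightarrow> level" where
  "levels p n = snd (dis (snd p (n - length (fst p))))"

definition split_cond :: "(nat, nat \<times> level) cond \<Rightarrow> (nat, nat \<times> level) cond \<times> (nat, nat \<times> level) cond" where
  "split_cond p = (cnd H \<pi>0 (restr \<pi>0 (fst p)) (levels p \<circ> \<pi>0), cnd H \<pi>1 (restr \<pi>1 (fst p)) (levels p \<circ> \<pi>1))"

lemma split_cond_cnd:
  "split_cond (cnd H id w a) = (cnd H \<pi>0 (restr \<pi>0 w) (a \<circ> \<pi>0), cnd H \<pi>1 (restr \<pi>1 w) (a \<circ> \<pi>1))"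
proof -
  have l: "levels (cnd H id w a) n = a n" if "length w \<le> n" for n
    using that by (simp add: levels_def cnd_def mk_def)
  have "cnd H \<pi> (restr \<pi> w) (levels (cnd H id w a) \<circ> \<pi>) = cnd H \<pi> (restr \<pi> w) (a \<circ> \<pi>)"
    if "strict_mono \<pi>" for \<pi>
    using l below_iff[OF that, of _ "length w"] by (intro cnd_eqI) (auto simp: not_less[symmetric])
  then show ?thesis using mono0 mono1 by (simp add: split_cond_def) (simp add: cnd_def)
qed

lemma le_split_cond_iff:
  assumes "p \<in> conds (Q_of H id)" "q \<in> conds (Q_of H id)"
  shows "le (Q_of H id) p q \<longleftrightarrow> le PP (split_cond p) (split_cond q)"
proof -
  obtain w a w' a' where *: "p = cnd H id w a" "q = cnd H id w' a'" "valid H id w a" "valid H id w' a'"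
    using assms unfolding conds_Q_of by blast
  then have v: "valid H \<pi>0 (restr \<pi>0 w) (a \<circ> \<pi>0)" "valid H \<pi>1 (restr \<pi>1 w) (a \<circ> \<pi>1)"
    "valid H \<pi>0 (restr \<pi>0 w') (a' \<circ> \<pi>0)" "valid H \<pi>1 (restr \<pi>1 w') (a' \<circ> \<pi>1)"
    by (simp_all add: valid_split_iff)
  show ?thesis unfolding *(1,2) split_cond_cnd le_prod_iff[OF v] le_cnd_iff[OF *(3,4)] by (rule ext_split_iff)
qed

lemma dense_stem_lengths:
  fixes nbar :: "nat \<Rightarrow> nat"
  assumes "strict_mono nbar"
  shows "dense_in (Q_of H id) {p \<in> conds (Q_of H id). \<exists>i. length (fst p) = nbar i}"
  unfolding dense_in_def
proof (intro conjI ballI)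
  fix p assume "p \<in> conds (Q_of H id)"
  then obtain w a where p: "p = cnd H id w a" "valid H id w a" unfolding conds_Q_of by blast
  obtain w' where w': "valid H id w' a" "ext w a w' a" "length w' = nbar (length w)"
    using extend_stem[OF p(2) strict_mono_imp_increasing[OF assms]] .
  have "cnd H id w' a \<in> conds (Q_of H id)" using w' unfolding conds_Q_of by blast
  moreover have "length (fst (cnd H id w' a)) = nbar (length w)" using w' by (simp add: cnd_def)
  ultimately show "\<exists>q\<in>{p \<in> conds (Q_of H id). \<exists>i. length (fst p) = nbar i}. le (Q_of H id) p q"
    using p w' by (intro bexI[of _ "cnd H id w' a"]) (simp add: le_cnd_iff, blast)
qed auto

lemma isomorphic_dense_suborder:
  fixes nbar :: "nat \<Rightarrow> nat"
  assumes "strict_mono nbar"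
  defines "Q \<equiv> {p \<in> conds (Q_of H id). \<exists>i. length (fst p) = nbar i}"
  shows "\<exists>R. dense_in PP R \<and> isomorphic_forcing (suborder (Q_of H id) Q) (suborder PP R)"
proof (intro exI conjI)
  have QC: "Q \<subseteq> conds (Q_of H id)" by (auto simp: Q_def)
  show "dense_in PP (split_cond ` Q)" unfolding dense_in_def
  proof (intro conjI ballI subsetI)
    fix r assume "r \<in> split_cond ` Q"
    then obtain w a where "valid H id w a" "r = split_cond (cnd H id w a)"
      using QC unfolding conds_Q_of by blast
    then show "r \<in> conds PP" unfolding conds_prod split_cond_cnd valid_split_iff[of H] by blast
  next
    fix p assume "p \<in> conds PP"
    then obtain w0 a0 w1 a1 where p: "p = (cnd H \<pi>0 w0 a0, cnd H \<pi>1 w1 a1)"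
      and v: "valid H \<pi>0 w0 a0" "valid H \<pi>1 w1 a1" unfolding conds_prod by blast
    define i where "i = max (\<pi>0 (length w0)) (\<pi>1 (length w1))"
    have "i \<le> nbar i" by (rule strict_mono_imp_increasing[OF assms(1)])
    then obtain w a where w: "length w = nbar i" "valid H id w a"
      "ext w0 a0 (restr \<pi>0 w) (a \<circ> \<pi>0)" "ext w1 a1 (restr \<pi>1 w) (a \<circ> \<pi>1)"
      using common_extension[OF v, of "nbar i"] by (auto simp: i_def)
    have "cnd H id w a \<in> conds (Q_of H id)" using w(2) unfolding conds_Q_of by blast
    then have "cnd H id w a \<in> Q" using w(1) by (auto simp: Q_def cnd_def)
    moreover have "le PP p (split_cond (cnd H id w a))"
      using w v by (simp add: p split_cond_cnd le_prod_iff valid_split_iff[of H w])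
    ultimately show "\<exists>q\<in>split_cond ` Q. le PP p q" by blast
  qed
  \<comment> \<open>The order is reflected, so conditions with the same image extend each other, and
    mutual extension means equality.\<close>
  have "inj_on split_cond Q"
  proof (rule inj_onI)
    fix p q assume pq: "p \<in> Q" "q \<in> Q" "split_cond p = split_cond q"
    have refl: "le (Q_of H id) p p" if "p \<in> Q" for p
    proof (rule forcing_notion_refl)
      show "forcing_notion (Q_of H id)" by (intro forcing_notion_Q_of) (simp add: strict_mono_def)
    qed (use that QC in blast)
    have "le (Q_of H id) p q" "le (Q_of H id) q p"
    proof -
      have c: "p \<in> conds (Q_of H id)" "q \<in> conds (Q_of H id)" using pq QC by blast+
      have "le PP (split_cond p) (split_cond p)" using refl[OF pq(1)] le_split_cond_iff[OF c(1) c(1)] by blast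
      then show "le (Q_of H id) p q" "le (Q_of H id) q p"
        unfolding le_split_cond_iff[OF c] le_split_cond_iff[OF c(2,1)] pq(3) by blast+
    qed
    moreover obtain w a w' a' where "p = cnd H id w a" "q = cnd H id w' a'" "valid H id w a" "valid H id w' a'"
      using pq QC unfolding conds_Q_of by blast
    ultimately show "p = q" using ext_prefix_antisym[of w a w' a'] cnd_eqI[of w a a'] by (simp add: le_cnd_iff)
  qed
  then show "isomorphic_forcing (suborder (Q_of H id) Q) (suborder PP (split_cond ` Q))"
    unfolding isomorphic_forcing_def suborder_def forcing.simps
  proof (intro exI[of _ split_cond] conjI ballI)
    show "bij_betw split_cond Q (split_cond ` Q)" if "inj_on split_cond Q" using that by (simp add: bij_betw_def)
    show "le (Q_of H id) p q \<longleftrightarrow> le PP (split_cond p) (split_cond q)" if "p \<in> Q" "q \<in> Q" for p q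
      using that QC by (intro le_split_cond_iff) blast+
  qed
qed

end

lemma splitting_pi_of:
  assumes "strict_mono nbar" "nbar 0 = 0"
  shows "splitting (pi_of nbar 0) (pi_of nbar 1)"
proof -
  \<comment> \<open>\<open>nbar\<close> itself satisfies the axioms on \<open>mbar\<close>; this
    lends the partition of the natural numbers into intervals.\<close>
  interpret level_sizes nbar using assms by unfold_locales
  have "U_of nbar 0 \<inter> U_of nbar 1 = {}"
  proof (intro equals0I)
    fix x assume "x \<in> U_of nbar 0 \<inter> U_of nbar 1"
    then obtain i i' where "nbar (2 * i) \<le> x" "x < nbar (Suc (2 * i))" "nbar (Suc (2 * i')) \<le> x" "x < nbar (Suc (Suc (2 * i')))"
      by (auto simp: U_of_def)
    then have "2 * i = Suc (2 * i')" by (intro block_unique)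
    then show False by presburger
  qed
  moreover have "x \<in> U_of nbar 0 \<union> U_of nbar 1" for x
  proof -
    obtain i where "nbar i \<le> x" "x < nbar (Suc i)" using ex_block by blast
    moreover have "i = 2 * (i div 2) \<or> i = 2 * (i div 2) + 1" by linarith
    ultimately show ?thesis unfolding U_of_def by (auto; metis Suc_eq_plus1 add_0_right)
  qed
  ultimately show ?thesis using assms(1)
    by unfold_locales (auto simp: range_pi_of intro: strict_mono_pi_of)
qed

section \<open>Collapsing the continuum\<close>

text \<open>\<open>D n p x\<close> describes in the ground model that \<open>p\<close> decides the
  \<open>n\<close>-th real to be \<open>x\<close>. It may leave an \<open>n\<close> undecided, even
  below every extension of some condition.\<close>

lemma collapses_continuumI:
  fixes D :: "nat \<Rightarrow> 'p \<Rightarrow> (nat \<Rightarrow> bool) \<Rightarrow> bool"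
  assumes P: "forcing_notion P"
    and up: "\<And>n p q x. p \<in> conds P \<Longrightarrow> q \<in> conds P \<Longrightarrow> le P p q \<Longrightarrow> D n p x \<Longrightarrow> D n q x"
    and cons: "\<And>n p x y. p \<in> conds P \<Longrightarrow> D n p x \<Longrightarrow> D n p y \<Longrightarrow> x = y"
    and dense: "\<And>p x. p \<in> conds P \<Longrightarrow> \<exists>n. \<exists>r\<in>conds P. le P p r \<and> D n r x"
  shows "collapses_continuum P"
proof -
  note tr = forcing_notion_trans[OF P] and rf = forcing_notion_refl[OF P]
  \<comment> \<open>The name has to be total, so the \<open>n\<close>-th real is constantly
    \<open>False\<close> where no extension decides it. A condition using this default has no
    extension in \<open>D\<close>, so the two clauses never conflict.\<close>
  define E where "E n p x \<longleftrightarrow> D n p x \<or> (x = (\<lambda>_. False) \<and> (\<forall>r\<in>conds P. le P p r \<longrightarrow> (\<forall>y. \<not> D n r y)))" for n p x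
  define F where "F = {(p, n, x). p \<in> conds P \<and> E n p x}"
  have E_up: "E n q x" if "p \<in> conds P" "q \<in> conds P" "le P p q" "E n p x" for n p q x
    using that(4) unfolding E_def
  proof (elim disjE conjE)
    assume "\<forall>r\<in>conds P. le P p r \<longrightarrow> (\<forall>y. \<not> D n r y)" "x = (\<lambda>_. False)"
    then show "D n q x \<or> (x = (\<lambda>_. False) \<and> (\<forall>r\<in>conds P. le P q r \<longrightarrow> (\<forall>y. \<not> D n r y)))"
      using tr[OF that(1,2) _ that(3)] by simp
  qed (use up[OF that(1-3)] in simp)
  have E_cons: "x = y" if "p \<in> conds P" "E n p x" "E n p y" for n p x y
    using that cons[OF that(1)] rf[OF that(1)] unfolding E_def by blast
  have F: "F \<in> names P (UNIV \<times> UNIV)" by (auto simp: F_def names_def)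
  have mem: "f_mem P (n, x) F p" if "p \<in> conds P" "E n p x" for n p x
    unfolding f_mem_def
  proof (intro ballI impI)
    fix q assume "q \<in> conds P" "le P p q"
    then show "\<exists>r\<in>conds P. le P q r \<and> (\<exists>s. (s, n, x) \<in> F \<and> le P s r)"
      using that rf unfolding F_def by (intro bexI[of _ q] conjI exI[of _ p]) auto
  qed
  have memD: "\<exists>r\<in>conds P. le P p r \<and> E n r x" if p: "p \<in> conds P" "f_mem P (n, x) F p" for n p x
  proof -
    obtain r s where "r \<in> conds P" "le P p r" "(s, n, x) \<in> F" "le P s r"
      using p rf[OF p(1)] unfolding f_mem_def by blast
    then show ?thesis using E_up[of s r n x] by (auto simp: F_def)
  qed
  have total: "\<exists>r\<in>conds P. le P p r \<and> (\<exists>x. E n r x)" if "p \<in> conds P" for n p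
  proof (cases "\<exists>r\<in>conds P. le P p r \<and> (\<exists>x. D n r x)")
    case True
    then show ?thesis unfolding E_def by blast
  next
    case False
    then have "E n p (\<lambda>_. False)" unfolding E_def by blast
    then show ?thesis using that rf[OF that] by blast
  qed
  have unique: "\<not> (f_mem P (n, x) F p \<and> f_mem P (n, y) F p)" if p: "p \<in> conds P" "x \<noteq> y" for n p x y
  proof
    assume *: "f_mem P (n, x) F p \<and> f_mem P (n, y) F p"
    then obtain q where q: "q \<in> conds P" "le P p q" "E n q x" using memD[OF p(1)] by blast
    have "f_mem P (n, y) F q" by (rule f_mem_mono[OF P p(1) q(1,2)]) (use * in blast)
    then obtain r where r: "r \<in> conds P" "le P q r" "E n r y" using memD[OF q(1)] by blast
    then show False using E_up[OF q(1) r(1,2) q(3)] E_cons[OF r(1)] p(2) by blast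
  qed
  have onto: "\<exists>r\<in>conds P. le P p r \<and> (\<exists>n. f_mem P (n, x) F r)" if p: "p \<in> conds P" for p x
  proof -
    obtain n r where "r \<in> conds P" "le P p r" "D n r x" using dense[OF p] by blast
    then show ?thesis using mem[of r n x] unfolding E_def by blast
  qed
  have fn: "f_function P F UNIV UNIV p" if p: "p \<in> conds P" for p
    unfolding f_function_def f_and_def f_all_def f_ex_def f_not_def
  proof (intro conjI ballI impI)
    fix n :: nat and q assume "q \<in> conds P" "le P p q"
    then show "\<exists>r\<in>conds P. le P q r \<and> (\<exists>x\<in>UNIV. f_mem P (n, x) F r)"
      using total[of q n] mem by blast
  next
    fix n :: nat and x y :: "nat \<Rightarrow> bool" and q assume "y \<in> UNIV - {x}" "q \<in> conds P"
    then show "\<not> (f_mem P (n, x) F q \<and> f_mem P (n, y) F q)" using unique by blast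
  qed
  have on: "f_all UNIV (\<lambda>x. f_ex P UNIV (\<lambda>n. f_mem P (n, x) F)) p" for p
    using onto unfolding f_all_def f_ex_def by simp
  show ?thesis
    unfolding collapses_continuum_def forced_def
  proof
    fix p assume "p \<in> conds P"
    show "f_ex P (names P (UNIV \<times> UNIV)) (\<lambda>F. f_and (f_function P F (UNIV :: nat set) (UNIV :: (nat \<Rightarrow> bool) set))
      (f_all UNIV (\<lambda>x. f_ex P UNIV (\<lambda>n. f_mem P (n, x) F)))) p"
      unfolding f_ex_def[of P "names P (UNIV \<times> UNIV)"]
    proof (intro ballI impI)
      fix q assume q: "q \<in> conds P"
      show "\<exists>r\<in>conds P. le P q r \<and> (\<exists>F\<in>names P (UNIV \<times> UNIV). f_and (f_function P F (UNIV :: nat set) (UNIV :: (nat \<Rightarrow> bool) set))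
        (f_all UNIV (\<lambda>x. f_ex P UNIV (\<lambda>n. f_mem P (n, x) F))) r)"
        using q rf[OF q] F fn[OF q] on[of q] unfolding f_and_def by blast
    qed
  qed
qed

section \<open>Splitting finite sets in two\<close>

lemma splitting_set:
  fixes \<P> :: "'a set set"
  assumes V: "finite V" and \<P>: "\<And>p. p \<in> \<P> \<Longrightarrow> p \<subseteq> V \<and> card p = s"
    and small: "2 * card \<P> < 2 ^ s"
  obtains Z where "Z \<subseteq> V" "\<And>p. p \<in> \<P> \<Longrightarrow> p \<inter> Z \<noteq> {} \<and> p - Z \<noteq> {}"
proof (cases "\<P> = {}")
  case True
  then show ?thesis using that[of "{}"] by simp
next
  case False
  have "\<P> \<subseteq> Pow V" using \<P> by blast
  then have fin: "finite \<P>" using V by (simp add: finite_subset)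
  have s: "s \<le> card V" using False \<P> V by (metis card_mono ex_in_conv)
  \<comment> \<open>The subsets of \<open>V\<close> that fail to split \<open>p\<close> are those
    disjoint from it and those containing it, \<open>2 ^ (card V - s)\<close> of each kind. By
    \<open>small\<close> they cannot exhaust \<open>Pow V\<close>, even for all \<open>p\<close>
    together.\<close>
  define bad where "bad p = Pow (V - p) \<union> (\<lambda>Z. Z \<union> p) ` Pow (V - p)" for p
  have bad: "card (bad p) \<le> 2 * 2 ^ (card V - s)" "finite (bad p)" if "p \<in> \<P>" for p
  proof -
    have f: "finite (Pow (V - p))" using V by simp
    have "card (V - p) = card V - s" using \<P>[OF that] V by (metis card_Diff_subset finite_subset)
    then have "card (Pow (V - p)) = 2 ^ (card V - s)" using V by (simp add: card_Pow)
    moreover have "card ((\<lambda>Z. Z \<union> p) ` Pow (V - p)) \<le> card (Pow (V - p))" by (rule card_image_le[OF f])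
    ultimately show "card (bad p) \<le> 2 * 2 ^ (card V - s)"
      unfolding bad_def using card_Un_le[of "Pow (V - p)" "(\<lambda>Z. Z \<union> p) ` Pow (V - p)"] by linarith
    show "finite (bad p)" using f by (simp add: bad_def)
  qed
  have "card (\<Union>p\<in>\<P>. bad p) \<le> (\<Sum>p\<in>\<P>. card (bad p))" by (rule card_UN_le[OF fin])
  also have "\<dots> \<le> (\<Sum>p\<in>\<P>. 2 * 2 ^ (card V - s))" by (intro sum_mono bad(1))
  also have "\<dots> = 2 * card \<P> * 2 ^ (card V - s)" by simp
  also have "\<dots> < 2 ^ s * 2 ^ (card V - s)" using small by simp
  also have "\<dots> = card (Pow V)" using V s by (simp add: card_Pow flip: power_add)
  finally have "\<not> Pow V \<subseteq> (\<Union>p\<in>\<P>. bad p)" using bad(2) fin by (metis card_mono finite_UN_I not_less)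
  then obtain Z where Z: "Z \<subseteq> V" "\<And>p. p \<in> \<P> \<Longrightarrow> Z \<notin> bad p" by blast
  show ?thesis
  proof (rule that[OF Z(1)])
    fix p assume p: "p \<in> \<P>"
    have "\<not> Z \<subseteq> V - p" "Z \<noteq> (Z - p) \<union> p" using Z p unfolding bad_def by blast+
    then show "p \<inter> Z \<noteq> {} \<and> p - Z \<noteq> {}" using Z(1) by blast
  qed
qed

lemma disjoint_pieces:
  assumes "finite A" "s * q \<le> card A"
  obtains f :: "nat \<Rightarrow> 'a set" where "\<And>t. t < q \<Longrightarrow> f t \<subseteq> A \<and> card (f t) = s" "disjoint_family_on f {..<q}"
proof -
  obtain h where h: "bij_betw h {0..<card A} A" using ex_bij_betw_nat_finite[OF assms(1)] by blast
  then have inj: "inj_on h {0..<card A}" by (simp add: bij_betw_def)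
  define I where "I t = {t * s..<t * s + s}" for t
  have I: "I t \<subseteq> {0..<card A}" if "t < q" for t
  proof -
    have "(t + 1) * s \<le> q * s" using that by (intro mult_right_mono) auto
    then have "t * s + s \<le> card A" using assms(2) by (simp add: algebra_simps)
    then show ?thesis by (auto simp: I_def)
  qed
  have I_disj: "I t \<inter> I t' = {}" if "t < t'" for t t'
  proof -
    have "(t + 1) * s \<le> t' * s" using that by (intro mult_right_mono) auto
    then show ?thesis by (auto simp: I_def)
  qed
  show ?thesis
  proof (rule that[of "\<lambda>t. h ` I t"])
    fix t assume t: "t < q"
    have "card (h ` I t) = card (I t)" using inj I[OF t] by (intro card_image) (rule inj_on_subset)
    then show "h ` I t \<subseteq> A \<and> card (h ` I t) = s" using I[OF t] h by (auto simp: I_def bij_betw_def)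
  next
    show "disjoint_family_on (\<lambda>t. h ` I t) {..<q}" unfolding disjoint_family_on_def
    proof (intro ballI impI)
      fix t t' assume t: "t \<in> {..<q}" "t' \<in> {..<q}" "t \<noteq> t'"
      then have "I t \<inter> I t' = {}" using I_disj[of t t'] I_disj[of t' t] by (cases "t < t'") auto
      then show "h ` I t \<inter> h ` I t' = {}" using inj I t by (simp flip: inj_on_image_Int[OF inj])
    qed
  qed
qed

lemma card_ge_transversal:
  assumes "finite B" "disjoint_family_on f {..<q}" "\<And>t. t < q \<Longrightarrow> f t \<inter> B \<noteq> {}"
  shows "q \<le> card B"
proof -
  define g where "g t = (SOME x. x \<in> f t \<inter> B)" for t
  have g: "g t \<in> f t \<inter> B" if "t < q" for t using assms(3)[OF that] unfolding g_def some_in_eq .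
  have "inj_on g {..<q}"
    using g assms(2) unfolding disjoint_family_on_def by (intro inj_onI) (metis IntD1 disjoint_iff lessThan_iff)
  moreover have "g ` {..<q} \<subseteq> B" using g by auto
  ultimately show ?thesis using card_inj_on_le[of g "{..<q}" B] assms(1) by simp
qed

text \<open>Each \<open>A j\<close> contains \<open>q j\<close> disjoint pieces of size
  \<open>s\<close>, and a set splitting every piece leaves one point per piece on either side. There
  are at most \<open>M * L\<close> pieces altogether.\<close>

lemma common_splitting_set:
  fixes A :: "nat \<Rightarrow> 'a set"
  assumes V: "finite V" and A: "\<And>j. j < M \<Longrightarrow> A j \<subseteq> V \<and> s * q j \<le> card (A j) \<and> q j \<le> L"
    and small: "2 * (M * L) < 2 ^ s"
  obtains Z where "Z \<subseteq> V" "\<And>j. j < M \<Longrightarrow> q j \<le> card (A j \<inter> Z) \<and> q j \<le> card (A j - Z)"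
proof -
  have fin: "finite (A j)" if "j < M" for j using A[OF that] V by (auto intro: finite_subset)
  have ex: "\<exists>f. (\<forall>t<q j. f t \<subseteq> A j \<and> card (f t) = s) \<and> disjoint_family_on f {..<q j}" if j: "j < M" for j
  proof -
    have sq: "s * q j \<le> card (A j)" using A[OF j] by blast
    obtain f :: "nat \<Rightarrow> 'a set" where "\<And>t. t < q j \<Longrightarrow> f t \<subseteq> A j \<and> card (f t) = s" "disjoint_family_on f {..<q j}"
      using disjoint_pieces[OF fin[OF j] sq] by metis
    then show ?thesis by (intro exI[of _ f]) simp
  qed
  define f where "f j = (SOME f. (\<forall>t<q j. f t \<subseteq> A j \<and> card (f t) = s) \<and> disjoint_family_on f {..<q j})" for j
  have f: "(\<forall>t<q j. f j t \<subseteq> A j \<and> card (f j t) = s) \<and> disjoint_family_on (f j) {..<q j}" if "j < M" for j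
    unfolding f_def by (rule someI_ex[OF ex[OF that]])
  have f1: "f j t \<subseteq> A j \<and> card (f j t) = s" if "j < M" "t < q j" for j t using f that by blast
  define I where "I = (SIGMA j:{..<M}. {..<q j})"
  have I: "finite I" by (simp add: I_def)
  have "card I = (\<Sum>j<M. q j)" by (simp add: I_def)
  also have "\<dots> \<le> (\<Sum>j<M. L)" using A by (intro sum_mono) auto
  finally have "card I \<le> M * L" by simp
  moreover have "card ((\<lambda>(j, t). f j t) ` I) \<le> card I" by (rule card_image_le[OF I])
  ultimately have sm: "2 * card ((\<lambda>(j, t). f j t) ` I) < 2 ^ s" using small by linarith
  have "p \<subseteq> V \<and> card p = s" if "p \<in> (\<lambda>(j, t). f j t) ` I" for p 
    using that f1 A unfolding I_def by fastforce
  then obtain Z where Z: "Z \<subseteq> V" "\<And>p. p \<in> (\<lambda>(j, t). f j t) ` I \<Longrightarrow> p \<inter> Z \<noteq> {} \<and> p - Z \<noteq> {}"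
    using splitting_set[OF V _ sm] by blast
  show ?thesis
  proof (rule that[OF Z(1)])
    fix j assume j: "j < M"
    have p: "f j t \<inter> Z \<noteq> {} \<and> f j t - Z \<noteq> {}" "f j t \<subseteq> A j" if "t < q j" for t
      
    proof -
      have "f j t \<in> (\<lambda>(j, t). f j t) ` I" using j that by (force simp: I_def)
      then show "f j t \<inter> Z \<noteq> {} \<and> f j t - Z \<noteq> {}" by (rule Z(2))
      show "f j t \<subseteq> A j" using f1[OF j that] by blast
    qed
    show "q j \<le> card (A j \<inter> Z) \<and> q j \<le> card (A j - Z)"
      using fin[OF j] p f[OF j] by (intro conjI card_ge_transversal[of _ "f j"]) blast+
  qed
qed

text \<open>The square root costs 1 in the double logarithm; passing on to the fourth root costs
  another 1 and covers the rounding. For slack at least 4 the loss of 2 is at most one half.\<close>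

lemma slack_root:
  assumes "a \<ge> 16" "slack a i \<ge> 4" "sqrt (real a) < real b + 1"
  shows "slack b i \<ge> slack a i / 2" "b \<ge> 2"
proof -
  have sq: "sqrt (real a) \<ge> 4" using assms(1) by (intro real_le_rsqrt) simp
  show "b \<ge> 2" using sq assms(3) by simp
  have 0: "real a > 0" using assms(1) by simp
  have "sqrt (sqrt (real a)) \<ge> 2" using assms(1) by (intro real_le_rsqrt) simp
  then have "2 * sqrt (sqrt (real a)) \<le> sqrt (sqrt (real a)) * sqrt (sqrt (real a))"
    by (intro mult_right_mono) auto
  then have "sqrt (sqrt (real a)) \<le> sqrt (real a) / 2" by simp
  also have "\<dots> \<le> sqrt (real a) - 1" using sq by simp
  finally have ba: "sqrt (sqrt (real a)) \<le> real b" using assms(3) by simp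
  have "log 2 (sqrt (sqrt (real a))) = log 2 (real a) / 4" using 0
    by (simp add: log_def ln_sqrt)
  moreover have "log 2 (sqrt (sqrt (real a))) \<le> log 2 (real b)" using ba 0 less_le_trans[OF _ ba, of 0]
    by (subst log_le_cancel_iff) auto
  ultimately have 1: "log 2 (real a) / 4 \<le> log 2 (real b)" by simp
  have "log 2 (real a) \<ge> log 2 (2 powr 4)" using assms(1) by (subst log_le_cancel_iff) auto
  moreover have "log 2 (2 powr 4) = (4::real)" by (rule log_powr_cancel) simp_all
  ultimately have 2: "log 2 (real a) \<ge> 4" by linarith
  have "log 2 (log 2 (real a) / 4) \<le> log 2 (log 2 (real b))" using 1 2 by simp
  moreover have "log 2 (log 2 (real a) / 4) = log 2 (log 2 (real a)) - log 2 (2 powr 2)"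
    using 2 by (simp add: log_divide)
  moreover have "log 2 (2 powr 2) = (2::real)" by (rule log_powr_cancel) simp_all
  ultimately have "slack b i \<ge> slack a i - 2" by (simp add: slack_def)
  then show "slack b i \<ge> slack a i / 2" using assms(2) by linarith
qed

text \<open>The arithmetic behind the bound 3 on norms: norm 3 gives slack \<open>8 ^ k\<close>, the
  threefold logarithm of the level size is at most \<open>(k + 1) ^ 2\<close>, and the summand 3
  becomes a factor 8, hence the eighth power in \<open>large_level\<close>.\<close>

lemma eight_power_ge: "k \<ge> 2 \<Longrightarrow> (k + 1) ^ 2 + 3 \<le> (8::nat) ^ k"
  by (induction k rule: dec_induct) (auto simp: power2_eq_square algebra_simps)

lemma forcing_notion_prod:
  assumes P: "forcing_notion P" and Q: "forcing_notion Q"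
  shows "forcing_notion (prod_forcing P Q)"
  unfolding forcing_notion_def prod_forcing_def forcing.simps
proof (intro conjI ballI impI)
  show "conds P \<times> conds Q \<noteq> {}" using P Q unfolding forcing_notion_def by blast
  fix x assume "x \<in> conds P \<times> conds Q"
  then show "le P (fst x) (fst x)" "le Q (snd x) (snd x)"
    using forcing_notion_refl[OF P] forcing_notion_refl[OF Q] by auto
next
  fix x y z assume xyz: "x \<in> conds P \<times> conds Q" "y \<in> conds P \<times> conds Q" "z \<in> conds P \<times> conds Q"
    and le: "le P (fst x) (fst y) \<and> le Q (snd x) (snd y)" "le P (fst y) (fst z) \<and> le Q (snd y) (snd z)"
  show "le P (fst x) (fst z)" 
    by (rule forcing_notion_trans[OF P, of _ "fst y"]) (use xyz le in auto)
  show "le Q (snd x) (snd z)" 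
    by (rule forcing_notion_trans[OF Q, of _ "snd y"]) (use xyz le in auto)
qed

text \<open>The subset in use in block \<open>n + t\<close>, starting with \<open>Z\<close> in block
  \<open>n\<close>. Block \<open>n + t + 1\<close> has \<open>n + t + 3\<close> values, so this many
  bits of block \<open>n + t\<close> are read.\<close>

primrec zset :: "(nat \<Rightarrow> nat) \<Rightarrow> (nat \<Rightarrow> nat) \<Rightarrow> nat \<Rightarrow> nat set \<Rightarrow> nat \<Rightarrow> nat set" where
  "zset mbar W n Z 0 = Z" |
  "zset mbar W n Z (Suc t) = {v. v < n + t + 3 \<and> W (mbar (n + t) + v) \<in> zset mbar W n Z t}"

text \<open>
  In block \<open>i\<close> the bits of the branch \<open>W\<close> are read off with a subset \<open>Z\<close> of \<open>H\<close>:
  the first \<open>i + 3\<close> bits are the characteristic function of the subset to be used in block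
  \<open>i + 1\<close>, and the following one is the next bit of the coded real.
\<close>

definition decode :: "(nat \<Rightarrow> nat) \<Rightarrow> (nat \<Rightarrow> nat) \<Rightarrow> nat \<Rightarrow> nat set \<Rightarrow> nat \<Rightarrow> bool" where
  "decode mbar W n Z t \<longleftrightarrow> W (mbar (n + t) + (n + t + 3)) \<in> zset mbar W n Z t"

definition index :: "nat \<Rightarrow> nat \<times> nat list" where
  "index = from_nat"

definition pset :: "nat list \<Rightarrow> (nat \<Rightarrow> level) \<Rightarrow> nat \<Rightarrow> nat set" where
  "pset w a m = (if m < length w then {w ! m} else fst (a m))"

lemma ext_pset: assumes "ext w a w' a'" shows "pset w' a' m \<subseteq> pset w a m"
  using assms unfolding ext_def prefix_iff_nth pset_def stronger_def by auto

section \<open>Splitting all sets of a block at once\<close>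

context level_sizes
begin

text \<open>The choice of \<open>k\<close> bounds the level size from above in terms of
  \<open>k\<close>, and norm 3 bounds the set from below in terms of \<open>k\<close>. Eliminating
  \<open>k\<close> compares the set with the logarithm of the level size.\<close>

lemma large_level:
  assumes x: "level_ok H n x" and nr: "nrm H n x \<ge> 3"
  shows "log 2 (real (l_of H n)) \<ge> 4" "log 2 (real (l_of H n)) ^ 4 \<le> sqrt (real (card (fst x)))"
    "slack (card (fst x)) (snd x) \<ge> 4"
proof -
  define a where "a = card (fst x)"
  define k where "k = k_of H n"
  have k2: "k \<ge> 2" unfolding k_def by (rule k_of_ge_2)
  have f: "f_norm k (real a) (real (snd x)) \<ge> 3" using nr by (simp add: nrm_def a_def k_def)
  then have f1: "f_norm k (real a) (real (snd x)) > 1" by simp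
  have a2: "a \<ge> 2" using f_norm_gt_1D[OF f1] by blast
  then have la: "log 2 (real a) \<ge> 1" by (simp add: le_log_iff)
  have "slack a (snd x) \<ge> 2 powr (real k * 3)" using f k2 by (intro slack_ge_powr) auto
  moreover have "2 powr (real k * 3) = real (8 ^ k)"
  proof -
    have "(2 powr 3) powr real k = 2 powr (3 * real k)" by (rule powr_powr)
    then show ?thesis by (simp add: powr_realpow mult.commute)
  qed
  ultimately have sl: "slack a (snd x) \<ge> real (8 ^ k)" by simp
  have "(8::nat) ^ 2 \<le> 8 ^ k" using k2 by (intro power_increasing) auto
  then have "real (8 ^ 2) \<le> real (8 ^ k)" by (simp only: of_nat_le_iff)
  then have sl64: "slack a (snd x) \<ge> 64" using sl by simp
  then show "slack (card (fst x)) (snd x) \<ge> 4" by (simp add: a_def)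
  have lla: "log 2 (log 2 (real a)) \<ge> slack a (snd x)" by (simp add: slack_def)
  have al: "a \<le> l_of H n" unfolding a_def l_of_def
    using x fin_H by (intro card_mono) (auto simp: level_ok_def)
  \<comment> \<open>Up to the threshold double logarithms are at most 16, whereas the norm forces at
    least 64.\<close>
  have big: "l_of H n > threshold"
  proof (rule ccontr)
    assume "\<not> l_of H n > threshold"
    then have "real a \<le> real threshold" using al by simp
    then have "log 2 (real a) \<le> log 2 (real threshold)" using a2 by simp
    then have "log 2 (log 2 (real a)) \<le> log 2 (log 2 (real threshold))" using la by simp
    then show False using lla sl64 log2_log2_threshold by linarith
  qed
  define L where "L = log 2 (real (l_of H n))"
  have L1: "L > 1" "log 2 L > 16" using k_of_large(5,6)[OF big] by (simp_all add: L_def)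
  have "2 powr 2 \<le> L" by (rule iffD1[OF le_log_iff]) (use L1 in linarith)+
  then show "log 2 (real (l_of H n)) \<ge> 4" by (simp add: L_def)
  have "log 2 (log 2 L) \<le> (real k + 1) ^ 2" using k_of_large(2)[OF big] by (simp add: L_def k_def)
  then have lL: "log 2 L \<le> 2 powr ((real k + 1) ^ 2)" using L1 by (simp add: log_le_iff)
  have "real ((k + 1) ^ 2 + 3) \<le> real (8 ^ k)" using eight_power_ge[OF k2] by (simp only: of_nat_le_iff)
  then have "(real k + 1) ^ 2 + 3 \<le> real (8 ^ k)"
    by (simp only: of_nat_add of_nat_power of_nat_1 of_nat_numeral)
  then have "(real k + 1) ^ 2 + 3 \<le> log 2 (log 2 (real a))" using sl lla by linarith
  then have "2 powr ((real k + 1) ^ 2 + 3) \<le> log 2 (real a)" using la by (subst (asm) le_log_iff) auto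
  then have "8 * 2 powr ((real k + 1) ^ 2) \<le> log 2 (real a)" by (simp add: powr_add)
  then have "8 * log 2 L \<le> log 2 (real a)" using lL by linarith
  moreover have "log 2 (L ^ 8) = 8 * log 2 L" using L1 by (simp add: log_nat_power)
  ultimately have "log 2 (L ^ 8) \<le> log 2 (real a)" by simp
  then have "L ^ 8 \<le> real a" using L1 a2 by (subst (asm) log_le_cancel_iff) auto
  moreover have "(L ^ 4) ^ 2 = L ^ 8" by (simp flip: power_mult)
  ultimately show "log 2 (real (l_of H n)) ^ 4 \<le> sqrt (real (card (fst x)))"
    unfolding L_def[symmetric] a_def[symmetric] by (intro real_le_rsqrt) simp
qed

lemma split_block:
  assumes block: "mbar i + (i + 4) \<le> mbar (Suc i)"
    and ok: "\<And>j. j < i + 4 \<Longrightarrow> level_ok H (mbar i + j) (x j)"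
    and nr: "\<And>j. j < i + 4 \<Longrightarrow> nrm H (mbar i + j) (x j) \<ge> 3"
  shows "\<exists>Z\<subseteq>{..<i + 2}. \<forall>j<i + 4. \<forall>B\<in>{fst (x j) \<inter> Z, fst (x j) - Z}.
    level_ok H (mbar i + j) (B, snd (x j)) \<and> nrm H (mbar i + j) (B, snd (x j)) \<ge> nrm H (mbar i + j) (x j) - 1"
proof -
  have l: "l_of H (mbar i + j) = i + 2" and Hj: "H (mbar i + j) = {..<i + 2}" if "j < i + 4" for j
    using block that l_block[of i "mbar i + j"] H_block[of i "mbar i + j"] by simp_all
  define L where "L = log 2 (real (i + 2))"
  note lg = large_level[OF ok nr]
  have L4: "L \<ge> 4" using lg(1)[of 0] l[of 0] by (simp add: L_def)
  \<comment> \<open>\<open>2 ^ s\<close> is at least \<open>8 * (i + 2) ^ 2\<close>, more than twice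
    the number of pieces, which is at most \<open>(i + 4) * (i + 2)\<close>.\<close>
  define s where "s = nat \<lceil>2 * L\<rceil> + 3"
  have s: "2 * L + 3 \<le> real s" "real s \<le> 2 * L + 4" using L4 unfolding s_def by linarith+
  \<comment> \<open>Since \<open>s \<le> q j\<close>, that many disjoint pieces of size
    \<open>s\<close> fit into the set. Each half keeps at least \<open>q j\<close> points, and
    passing to a root costs at most 1 in norm.\<close>
  define q where "q j = nat \<lfloor>sqrt (real (card (fst (x j))))\<rfloor>" for j
  have q: "real (q j) \<le> sqrt (real (card (fst (x j))))" "sqrt (real (card (fst (x j)))) < real (q j) + 1" for j
    unfolding q_def by (auto simp: of_nat_nat)
  have qq: "q j * q j \<le> card (fst (x j))" for j
  proof -
    have "real (q j) * real (q j) \<le> sqrt (real (card (fst (x j)))) * sqrt (real (card (fst (x j))))"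
      using q(1)[of j] by (intro mult_mono) auto
    then show ?thesis by (simp flip: of_nat_mult)
  qed
  have sq: "s \<le> q j" if "j < i + 4" for j
  proof -
    have "4 * 4 * 4 * L \<le> L * L * L * L" using L4 by (intro mult_mono) auto
    also have "\<dots> = L ^ 4" by (simp add: power4_eq_xxxx)
    finally have "64 * L \<le> sqrt (real (card (fst (x j))))"
      using lg(2)[of j] l that by (simp add: L_def)
    then have "real s < real (q j) + 1" using s(2) q(2)[of j] L4 by linarith
    then show ?thesis by simp
  qed
  have A: "fst (x j) \<subseteq> {..<i + 2} \<and> s * q j \<le> card (fst (x j)) \<and> q j \<le> i + 2" if "j < i + 4" for j
  proof -
    have sub: "fst (x j) \<subseteq> {..<i + 2}" using ok[OF that] Hj[OF that] by (simp add: level_ok_def)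
    then have "card (fst (x j)) \<le> i + 2" using card_mono[of "{..<i + 2}"] by simp
    moreover have "q j \<le> q j * q j" by simp
    moreover have "s * q j \<le> q j * q j" using sq[OF that] by simp
    ultimately show ?thesis using sub qq[of j] by linarith
  qed
  have small: "2 * ((i + 4) * (i + 2)) < 2 ^ s"
  proof -
    have "real (2 * ((i + 4) * (i + 2))) \<le> 4 * real (i + 2) ^ 2" by (simp add: power2_eq_square algebra_simps)
    also have "\<dots> < 8 * real (i + 2) ^ 2" by simp
    also have "real (i + 2) = 2 powr L" by (simp add: L_def)
    also have "8 * (2 powr L) ^ 2 = 2 powr (2 * L + 3)" 
    proof -
      have "2 powr (2 * L + 3) = 2 powr L * 2 powr L * 2 powr 3" by (simp only: mult_2 powr_add)
      then show ?thesis by (simp only: power2_eq_square) simp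
    qed
    also have "\<dots> \<le> 2 powr real s" using s(1) by simp
    also have "\<dots> = real (2 ^ s)" by (simp add: powr_realpow)
    finally show ?thesis by (simp only: of_nat_less_iff)
  qed
  obtain Z where Z: "Z \<subseteq> {..<i + 2}"
    "\<And>j. j < i + 4 \<Longrightarrow> q j \<le> card (fst (x j) \<inter> Z) \<and> q j \<le> card (fst (x j) - Z)"
    using common_splitting_set[of "{..<i + 2}" "i + 4" "\<lambda>j. fst (x j)" s q "i + 2"] A small by blast
  have "level_ok H (mbar i + j) (B, snd (x j)) \<and> nrm H (mbar i + j) (B, snd (x j)) \<ge> nrm H (mbar i + j) (x j) - 1"
    if j: "j < i + 4" and B: "B \<in> {fst (x j) \<inter> Z, fst (x j) - Z}" for j B
  proof -
    have qB: "q j \<le> card B" using Z(2)[OF j] B by auto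
    have "s \<ge> 3" by (simp add: s_def)
    then have "card B > 0" using qB sq[OF j] by linarith
    then have "B \<noteq> {}" by auto
    moreover have "B \<subseteq> fst (x j)" using B by auto
    ultimately have okB: "level_ok H (mbar i + j) (B, snd (x j))" using ok[OF j] by (auto simp: level_ok_def)
    define a where "a = card (fst (x j))"
    have "real s \<ge> 4" using L4 s(1) by linarith
    then have "4 * 4 \<le> s * s" by (intro mult_mono) simp_all
    also have "s * s \<le> q j * q j" using sq[OF j] by (intro mult_mono) auto
    finally have a16: "a \<ge> 16" using qq[of j] by (simp add: a_def)
    have sl: "slack a (snd (x j)) \<ge> 4" using lg(3)[of j] j by (simp add: a_def)
    have "sqrt (real a) < real (card B) + 1" using q(2)[of j] qB by (simp add: a_def)
    note r = slack_root[OF a16 sl this]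
    have "f_norm (k_of H (mbar i + j)) (real (card B)) (real (snd (x j))) \<ge>
        f_norm (k_of H (mbar i + j)) (real a) (real (snd (x j))) - 1 / real (k_of H (mbar i + j))"
      using nr[OF j] r k_pos[of "mbar i + j"] by (intro f_norm_drop) (auto simp: nrm_def a_def)
    moreover have "1 / real (k_of H (mbar i + j)) \<le> 1" using k_pos[of "mbar i + j"] by simp
    ultimately show ?thesis using okB by (simp add: nrm_def a_def)
  qed
  then show ?thesis using Z(1) by blast
qed

definition block :: "nat \<Rightarrow> nat" where
  "block n = (THE i. mbar i \<le> n \<and> n < mbar (Suc i))"

lemma block_eq: "mbar i \<le> n \<Longrightarrow> n < mbar (Suc i) \<Longrightarrow> block n = i"
  unfolding block_def using block_unique by (intro the_equality) blast+

lemma block_bounds: "mbar (block n) \<le> n" "n < mbar (Suc (block n))"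
  using ex_block[of n] block_eq by metis+

end

section \<open>Deciding the coded reals\<close>

locale collapse = level_sizes + splitting +
  assumes long: "mbar (Suc i) - mbar i > 4 ^ (i + 3)"
begin

sublocale split_forcing H \<pi>0 \<pi>1 ..

lemma long_block: "mbar i + (i + 4) \<le> mbar (Suc i)"
proof -
  have "i + 3 < 4 ^ (i + 3)" by (rule less_exp[THEN less_le_trans]) (rule power_mono; simp)
  then show ?thesis using long[of i] by linarith
qed

text \<open>\<open>k\<close> codes a starting block and a starting subset. Quantifying over all
  branches \<open>W\<close> of the ground model that pass through the pair replaces the generic
  branch by a combinatorial statement.\<close>

definition decides :: "nat \<Rightarrow> (nat, nat \<times> level) cond \<times> (nat, nat \<times> level) cond \<Rightarrow> (nat \<Rightarrow> bool) \<Rightarrow> bool" where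
  "decides k p x \<longleftrightarrow> (\<exists>w0 a0 w1 a1. p = (cnd H \<pi>0 w0 a0, cnd H \<pi>1 w1 a1) \<and>
    valid H \<pi>0 w0 a0 \<and> valid H \<pi>1 w1 a1 \<and>
    (\<forall>W. (\<forall>m. W (\<pi>0 m) \<in> pset w0 a0 m) \<longrightarrow> (\<forall>m. W (\<pi>1 m) \<in> pset w1 a1 m) \<longrightarrow>
      decode mbar W (fst (index k)) (set (snd (index k))) = x))"

lemma decides_up:
  assumes "decides k p x" "q \<in> conds PP" "le PP p q"
  shows "decides k q x"
proof -
  obtain w0 a0 w1 a1 where p: "p = (cnd H \<pi>0 w0 a0, cnd H \<pi>1 w1 a1)"
    "valid H \<pi>0 w0 a0" "valid H \<pi>1 w1 a1"
    "\<And>W. (\<forall>m. W (\<pi>0 m) \<in> pset w0 a0 m) \<Longrightarrow> (\<forall>m. W (\<pi>1 m) \<in> pset w1 a1 m) \<Longrightarrow>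
      decode mbar W (fst (index k)) (set (snd (index k))) = x"
    using assms(1) unfolding decides_def by blast
  obtain u0 b0 u1 b1 where q: "q = (cnd H \<pi>0 u0 b0, cnd H \<pi>1 u1 b1)"
    "valid H \<pi>0 u0 b0" "valid H \<pi>1 u1 b1"
    using assms(2) unfolding conds_prod by blast
  have e: "ext w0 a0 u0 b0" "ext w1 a1 u1 b1" using assms(3) p q by (simp_all add: le_prod_iff)
  show ?thesis unfolding decides_def
  proof (intro exI conjI allI impI)
    show "q = (cnd H \<pi>0 u0 b0, cnd H \<pi>1 u1 b1)" "valid H \<pi>0 u0 b0" "valid H \<pi>1 u1 b1" by fact+
    fix W assume "\<forall>m. W (\<pi>0 m) \<in> pset u0 b0 m" "\<forall>m. W (\<pi>1 m) \<in> pset u1 b1 m"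
    then show "decode mbar W (fst (index k)) (set (snd (index k))) = x"
      using ext_pset[OF e(1)] ext_pset[OF e(2)] by (intro p(4)) blast+
  qed
qed

text \<open>Representations of a pair differ only in the irrelevant levels below the stems, so they
  admit the same branches. Some branch exists, and it decodes to only one real.\<close>

lemma decides_unique:
  assumes "decides k p x" "decides k p y"
  shows "x = y"
proof -
  obtain w0 a0 w1 a1 where p: "p = (cnd H \<pi>0 w0 a0, cnd H \<pi>1 w1 a1)"
    "valid H \<pi>0 w0 a0" "valid H \<pi>1 w1 a1"
    "\<And>W. (\<forall>m. W (\<pi>0 m) \<in> pset w0 a0 m) \<Longrightarrow> (\<forall>m. W (\<pi>1 m) \<in> pset w1 a1 m) \<Longrightarrow>
      decode mbar W (fst (index k)) (set (snd (index k))) = x"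
    using assms(1) unfolding decides_def by blast
  obtain u0 b0 u1 b1 where q: "p = (cnd H \<pi>0 u0 b0, cnd H \<pi>1 u1 b1)"
    "valid H \<pi>0 u0 b0" "valid H \<pi>1 u1 b1"
    "\<And>W. (\<forall>m. W (\<pi>0 m) \<in> pset u0 b0 m) \<Longrightarrow> (\<forall>m. W (\<pi>1 m) \<in> pset u1 b1 m) \<Longrightarrow>
      decode mbar W (fst (index k)) (set (snd (index k))) = y"
    using assms(2) unfolding decides_def by blast
  have "cnd H \<pi>0 w0 a0 = cnd H \<pi>0 u0 b0" "cnd H \<pi>1 w1 a1 = cnd H \<pi>1 u1 b1" using p(1) q(1) by simp_all
  then have "ext w0 a0 u0 b0" "ext w1 a1 u1 b1"
    using le_cnd_iff[OF p(2) p(2)] le_cnd_iff[OF p(2) q(2)] le_cnd_iff[OF p(3) p(3)] le_cnd_iff[OF p(3) q(3)]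
    by (simp_all add: ext_refl)
  note sub = this[THEN ext_pset]
  have "pset u0 b0 m \<noteq> {}" "pset u1 b1 m \<noteq> {}" for m
    using q(2,3) by (auto simp: pset_def valid_def level_ok_def)
  then have ne: "(SOME v. v \<in> pset u0 b0 m) \<in> pset u0 b0 m" "(SOME v. v \<in> pset u1 b1 m) \<in> pset u1 b1 m" for m
    by (simp_all add: some_in_eq)
  obtain W where W: "\<And>m. W (\<pi>0 m) = (SOME v. v \<in> pset u0 b0 m)" "\<And>m. W (\<pi>1 m) = (SOME v. v \<in> pset u1 b1 m)"
    using merge[of "\<lambda>m. SOME v. v \<in> pset u0 b0 m" "\<lambda>m. SOME v. v \<in> pset u1 b1 m"] by blast
  have W0: "\<forall>m. W (\<pi>0 m) \<in> pset u0 b0 m" "\<forall>m. W (\<pi>1 m) \<in> pset u1 b1 m" using ne by (simp_all add: W)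
  then have "\<forall>m. W (\<pi>0 m) \<in> pset w0 a0 m" "\<forall>m. W (\<pi>1 m) \<in> pset w1 a1 m" using sub by blast+
  from p(4)[OF this] q(4)[OF W0] show ?thesis by simp
qed

lemma decides_dense:
  assumes "p \<in> conds PP"
  shows "\<exists>k. \<exists>r\<in>conds PP. le PP p r \<and> decides k r x"
proof -
  obtain w0 a0 w1 a1 where p: "p = (cnd H \<pi>0 w0 a0, cnd H \<pi>1 w1 a1)"
    and v: "valid H \<pi>0 w0 a0" "valid H \<pi>1 w1 a1" using assms unfolding conds_prod by blast
  obtain g where g: "\<And>m. g (\<pi>0 m) = a0 m" "\<And>m. g (\<pi>1 m) = a1 m" using merge[of a0 a1] by blast
  then have gc: "g \<circ> \<pi>0 = a0" "g \<circ> \<pi>1 = a1" by auto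
  have tg: "tends H id g" using v unfolding tends_split_iff gc by (simp add: valid_def)
  then obtain N1 where N1: "\<forall>n\<ge>N1. nrm H n (g n) \<ge> 3" unfolding tends_iff by auto
  \<comment> \<open>From \<open>N\<close> on both stems have ended and all norms are at least 3, as
    \<open>split_block\<close> demands.\<close>
  define N where "N = max N1 (max (\<pi>0 (length w0)) (\<pi>1 (length w1)))"
  have N0: "m \<ge> length w0" if "\<pi>0 m \<ge> N" for m
  proof -
    have "\<pi>0 (length w0) \<le> \<pi>0 m" using that by (simp add: N_def)
    then show ?thesis using mono0 by (simp add: strict_mono_less_eq)
  qed
  have N1': "m \<ge> length w1" if "\<pi>1 m \<ge> N" for m
  proof -
    have "\<pi>1 (length w1) \<le> \<pi>1 m" using that by (simp add: N_def)
    then show ?thesis using mono1 by (simp add: strict_mono_less_eq)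
  qed
  have "\<forall>n. n \<ge> N \<longrightarrow> level_ok H n (g n)"
    by (rule iffD2[OF split_all]) (use v N0 N1' in \<open>auto simp: valid_def g\<close>)
  then have okN: "level_ok H n (g n)" if "n \<ge> N" for n using that by blast
  have nrN: "nrm H n (g n) \<ge> 3" if "n \<ge> N" for n using N1 that by (simp add: N_def)
  have mN: "mbar i \<ge> N" if "i \<ge> N" for i using strict_mono_imp_increasing[OF mono, of i] that by linarith
  define good where "good i Z \<longleftrightarrow> Z \<subseteq> {..<i + 2} \<and> (\<forall>j<i + 4. \<forall>B\<in>{fst (g (mbar i + j)) \<inter> Z, fst (g (mbar i + j)) - Z}.
    level_ok H (mbar i + j) (B, snd (g (mbar i + j))) \<and>
    nrm H (mbar i + j) (B, snd (g (mbar i + j))) \<ge> nrm H (mbar i + j) (g (mbar i + j)) - 1)" for i Z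
  have "\<exists>Z. i \<ge> N \<longrightarrow> good i Z" for i
  proof (cases "i \<ge> N")
    case True
    then have "mbar i + j \<ge> N" for j using mN[of i] by linarith
    then show ?thesis using split_block[of i "\<lambda>j. g (mbar i + j)", OF long_block] okN nrN
      unfolding good_def by blast
  qed simp
  then obtain Z where Z: "\<And>i. i \<ge> N \<Longrightarrow> good i (Z i)" by metis
  have Zsub: "Z i \<subseteq> {..<i + 2}" if "i \<ge> N" for i using Z[OF that] unfolding good_def by blast
  \<comment> \<open>The bits to be forced in block \<open>i\<close>: the first \<open>i + 3\<close>
    describe \<open>Z (Suc i)\<close>, and the next is a bit of \<open>x\<close>, counted from the
    starting block \<open>N\<close>.\<close>
  define T where "T i j = (if j < i + 3 then j \<in> Z (Suc i) else x (i - N))" for i j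
  define sel where "sel i j y = (if T i j then fst y \<inter> Z i else fst y - Z i, snd y)" for i j and y :: level
  \<comment> \<open>Only the coding places shrink, each by at most 1 in norm, so the norms still
    tend to infinity.\<close>
  define g' where "g' n = (if block n \<ge> N \<and> n - mbar (block n) < block n + 4
    then sel (block n) (n - mbar (block n)) (g n) else g n)" for n
  have g'_coded: "g' (mbar i + j) = sel i j (g (mbar i + j))" if "i \<ge> N" "j < i + 4" for i j
  proof -
    have "block (mbar i + j) = i" using long_block[of i] that by (intro block_eq) linarith+
    then show ?thesis using that by (simp add: g'_def)
  qed
  have str: "stronger (g n) (g' n)" for n by (auto simp: g'_def sel_def stronger_def)
  have g'N: "(level_ok H n (g n) \<longrightarrow> level_ok H n (g' n)) \<and> nrm H n (g' n) \<ge> nrm H n (g n) - 1" for n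
  proof (cases "block n \<ge> N \<and> n - mbar (block n) < block n + 4")
    case True
    define i j where "i = block n" and "j = n - mbar (block n)"
    have n: "n = mbar i + j" using block_bounds(1)[of n] by (simp add: i_def j_def)
    have "i \<ge> N" "j < i + 4" using True by (simp_all add: i_def j_def)
    then show ?thesis using Z[of i] unfolding n g'_coded[OF \<open>i \<ge> N\<close> \<open>j < i + 4\<close>] good_def sel_def by simp
  next
    case False
    then have "g' n = g n" unfolding g'_def by (rule if_not_P)
    then show ?thesis by simp
  qed
  have tg': "tends H id g'" unfolding tends_iff
  proof
    fix Y
    obtain M where M: "\<forall>n\<ge>M. nrm H (id n) (g n) \<ge> Y + 1" using tg unfolding tends_iff by blast
    have "Y \<le> nrm H (id n) (g' n)" if "n \<ge> M" for n
    proof -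
      have "nrm H n (g n) \<ge> Y + 1" using M that by simp
      then show ?thesis using g'N[of n] by simp
    qed
    then show "\<exists>N. \<forall>n\<ge>N. Y \<le> nrm H (id n) (g' n)" by blast
  qed
  have v': "valid H \<pi>0 w0 (g' \<circ> \<pi>0)" "valid H \<pi>1 w1 (g' \<circ> \<pi>1)"
    using v tg' g'N by (simp_all add: valid_def tends_split_iff flip: g)
  have e: "ext w0 a0 w0 (g' \<circ> \<pi>0)" "ext w1 a1 w1 (g' \<circ> \<pi>1)"
    using str by (auto simp: ext_def g[symmetric])
  define r where "r = (cnd H \<pi>0 w0 (g' \<circ> \<pi>0), cnd H \<pi>1 w1 (g' \<circ> \<pi>1))"
  have r: "r \<in> conds PP" using v' unfolding conds_prod r_def by blast
  have pr: "le PP p r" using v v' e by (simp add: p r_def le_prod_iff)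
  \<comment> \<open>Only the starting block and its subset have to be named; every later subset is
    recovered from the branch. As these are finite data, countably many indices suffice.\<close>
  define k where "k = to_nat (N, sorted_list_of_set (Z N))"
  have "finite (Z N)" using Zsub[of N] by (auto intro: finite_subset)
  then have k: "fst (index k) = N" "set (snd (index k)) = Z N" by (simp_all add: k_def index_def)
  have "decode mbar W N (Z N) = x" if W: "\<forall>m. W (\<pi>0 m) \<in> pset w0 (g' \<circ> \<pi>0) m" "\<forall>m. W (\<pi>1 m) \<in> pset w1 (g' \<circ> \<pi>1) m" for W
  proof -
    have "\<forall>n. n \<ge> N \<longrightarrow> W n \<in> fst (g' n)"
    proof (rule iffD2[OF split_all], intro conjI allI impI)
      show "W (\<pi>0 m) \<in> fst (g' (\<pi>0 m))" if "\<pi>0 m \<ge> N" for m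
        using W(1)[rule_format, of m] N0[OF that] by (simp add: pset_def)
      show "W (\<pi>1 m) \<in> fst (g' (\<pi>1 m))" if "\<pi>1 m \<ge> N" for m
        using W(2)[rule_format, of m] N1'[OF that] by (simp add: pset_def)
    qed
    \<comment> \<open>The chosen half lies entirely inside or entirely outside \<open>Z i\<close>,
      so every branch has the prescribed bit.\<close>
    then have bit: "W (mbar i + j) \<in> Z i \<longleftrightarrow> T i j" if "i \<ge> N" "j < i + 4" for i j
    proof -
      have "mbar i + j \<ge> N" using mN[OF that(1)] by linarith
      then have "W (mbar i + j) \<in> fst (sel i j (g (mbar i + j)))"
        using \<open>\<forall>n. n \<ge> N \<longrightarrow> W n \<in> fst (g' n)\<close> g'_coded[OF that] by metis
      then show ?thesis by (auto simp: sel_def split: if_splits)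
    qed
    have z: "zset mbar W N (Z N) t = Z (N + t)" for t
    proof (induction t)
      case (Suc t)
      have "zset mbar W N (Z N) (Suc t) = {v. v < N + t + 3 \<and> W (mbar (N + t) + v) \<in> Z (N + t)}"
        by (simp add: Suc)
      also have "\<dots> = {v. v < N + t + 3 \<and> v \<in> Z (Suc (N + t))}"
        using bit[of "N + t"] by (auto simp: T_def)
      also have "\<dots> = Z (N + Suc t)" using Zsub[of "Suc (N + t)"] by auto
      finally show ?case .
    qed simp
    show ?thesis
    proof
      fix t show "decode mbar W N (Z N) t = x t"
        unfolding decode_def z using bit[of "N + t" "N + t + 3"] by (simp add: T_def)
    qed
  qed
  then have "decides k r x" unfolding decides_def k r_def using v' by blast
  then show ?thesis using r pr by blast
qed

lemma collapses: "collapses_continuum PP"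
proof (rule collapses_continuumI[where D = decides])
  show "forcing_notion PP"
    by (intro forcing_notion_prod forcing_notion_Q_of mono0 mono1)
qed (use decides_up decides_unique decides_dense in blast)+

end

theorem corollary4p7:
  fixes mbar nbar :: "nat \<Rightarrow> nat"
  assumes "strict_mono mbar" and "mbar 0 = 0"
    and "\<And>i. mbar (Suc i) - mbar i > 4 ^ (i + 3)"
    and "strict_mono nbar" and "nbar 0 = 0"
    and "\<And>i. k_of (H_of mbar) (nbar (Suc i)) \<ge> 2 * (\<Prod>j<nbar i. card (H_of mbar j))"
  shows "(\<forall>l\<in>{0, 1}. proper_forcing TYPE('x) (Q_of (H_of mbar) (pi_of nbar l))) \<and>
    (let Qstar = Q_of (H_of mbar) id;
         Q = {p \<in> conds Qstar. \<exists>i. length (fst p) = nbar i};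
         Qprod = prod_forcing (Q_of (H_of mbar) (pi_of nbar 0)) (Q_of (H_of mbar) (pi_of nbar 1))
     in dense_in Qstar Q \<and>
        (\<exists>R. dense_in Qprod R \<and> isomorphic_forcing (suborder Qstar Q) (suborder Qprod R)) \<and>
        collapses_continuum Qprod)"
proof -
  interpret splitting "pi_of nbar 0" "pi_of nbar 1" using assms(4,5) by (rule splitting_pi_of)
  interpret collapse mbar "pi_of nbar 0" "pi_of nbar 1" by unfold_locales (fact assms)+
  show ?thesis unfolding Let_def
    by (intro conjI ballI proper_Q_of_pi_of[OF assms(4,6)] dense_stem_lengths[OF assms(4)]
      isomorphic_dense_suborder[OF assms(4)] collapses)
qed

end
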